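(* Let $\Theta=(\alpha,\beta)$ be a bounded interval, let the functions $f(\vartheta),a(\vartheta),b(\vartheta)$, $\vartheta\in[\alpha,\beta]$, with $a(\vartheta)>0$ on $[\alpha,\beta]$, have two continuous derivatives, and suppose $$\inf_{\vartheta\in\Theta}\left|\dot\Psi(\vartheta)\right|>0 .$$ Then the method of moments estimator $\vartheta^*_T$ (defined in the context) is uniformly consistent, i.e. for every $\nu>0$, $\lim_{T\to\infty}\sup_{\vartheta_0\in\Theta}\mathbf P_{\vartheta_0}\left(|\vartheta_T^*-\vartheta_0|>\nu\right)=0$, and for every compact $\mathbf K\subset\Theta$ and every $p\ge2$ there is a constant $C>0$ such that for all $T$ $$\sup_{\vartheta_0\in\mathbf K}T^{p/2}\,\mathbf E_{\vartheta_0}\left|\vartheta_T^*-\vartheta_0\right|^p\le C.$$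
   Context: Model. One observes $X^T=(X_t,0\le t\le T)$, $T$ integer, from $$dX_t=f(\vartheta)Y_t\,dt+\sigma\,dW_t,\quad X_0,\qquad dY_t=-a(\vartheta)Y_t\,dt+b(\vartheta)\,dV_t,\quad Y_0,$$ where $W,V$ are independent Wiener processes, $X_0\sim\mathcal N(0,d_x^2)$ and $Y_0\sim\mathcal N(0,d_y^2)$ are independent of them, $\sigma>0$ is known, $f,a,b$ are known functions, $Y$ is not observed, and $\vartheta\in\Theta$ is unknown; $\mathbf P_{\vartheta_0},\mathbf E_{\vartheta_0}$ refer to the true value $\vartheta_0$. A dot denotes the derivative with respect to $\vartheta$. Estimator. Put $$R_{1,T}=\frac1T\sum_{k=1}^T[X_k-X_{k-1}]^2,\qquad\Psi(\vartheta)=\frac{f(\vartheta)^2b(\vartheta)^2}{a(\vartheta)^3}\left[e^{-a(\vartheta)}-1+a(\vartheta)\right]+\sigma^2,$$ $$\vartheta_T^*=\arg\inf_{\vartheta\in\Theta}\left|R_{1,T}-\Psi(\vartheta)\right|$$ (a measurable choice; if the infimum is not attained in $\Theta$ it is attained at an endpoint of $[\alpha,\beta]$). *)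

theory Defs
  imports "HOL-Probability.Probability"
begin

text \<open>The normal law with mean \<open>m\<close> and variance \<open>v\<close>; for \<open>v = 0\<close> it is the point mass at \<open>m\<close>.\<close>

definition gaussian :: "real \<Rightarrow> real \<Rightarrow> real measure" where
  "gaussian m v =
     (if v = 0 then return borel m else density lborel (\<lambda>x. ennreal (normal_density m (sqrt v) x)))"

abbreviation path_space :: "real set \<Rightarrow> (real \<Rightarrow> real) measure" where
  "path_space I \<equiv> PiM I (\<lambda>_. borel)"

abbreviation path_on :: "real set \<Rightarrow> (real \<Rightarrow> 'a \<Rightarrow> real) \<Rightarrow> 'a \<Rightarrow> real \<Rightarrow> real" where
  "path_on I Z \<omega> \<equiv> (\<lambda>t\<in>I. Z t \<omega>)"

text \<open>Processes are indexed by the reals, but only the times \<open>t \<ge> 0\<close> are ever constrained.\<close>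

definition wiener_process :: "'a measure \<Rightarrow> (real \<Rightarrow> 'a \<Rightarrow> real) \<Rightarrow> bool" where
  "wiener_process M W \<longleftrightarrow>
     (\<forall>t\<ge>0. W t \<in> borel_measurable M) \<and>
     (AE \<omega> in M. W 0 \<omega> = 0) \<and>
     (AE \<omega> in M. continuous_on {0..} (\<lambda>t. W t \<omega>)) \<and>
     (\<forall>s t. 0 \<le> s \<longrightarrow> s \<le> t \<longrightarrow>
        distr M borel (\<lambda>\<omega>. W t \<omega> - W s \<omega>) = gaussian 0 (t - s)) \<and>
     (\<forall>(n::nat) \<tau>. 0 \<le> \<tau> 0 \<longrightarrow> mono_on {..n} \<tau> \<longrightarrow>
        prob_space.indep_vars M (\<lambda>_. borel) (\<lambda>i \<omega>. W (\<tau> (Suc i)) \<omega> - W (\<tau> i) \<omega>) {..<n})"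

text \<open>
  The system \<open>dX = f Y dt + \<sigma> dW\<close>, \<open>dY = - a Y dt + b dV\<close>, with \<open>f, a, b\<close> the values of the
  coefficients at a given parameter. The noise is additive with constant coefficients, so the
  stochastic integrals are \<open>\<sigma> W\<^sub>t\<close> and \<open>b V\<^sub>t\<close>, and the integral form of the equations can be
  required path by path. The initial values are \<open>X 0\<close> and \<open>Y 0\<close>; the pair of them is independent of the
  pair of noises, while nothing is required between \<open>X 0\<close> and \<open>Y 0\<close>. This independence is stated
  for the generated sigma-algebras because \<open>indep_var\<close> needs both variables to have the same type.
\<close>

definition partially_observed_system ::
  "'a measure \<Rightarrow> real \<Rightarrow> real \<Rightarrow> real \<Rightarrow> real \<Rightarrow> real \<Rightarrow> real \<Rightarrow>
   (real \<Rightarrow> 'a \<Rightarrow> real) \<Rightarrow> (real \<Rightarrow> 'a \<Rightarrow> real) \<Rightarrow> (real \<Rightarrow> 'a \<Rightarrow> real) \<Rightarrow> (real \<Rightarrow> 'a \<Rightarrow> real) \<Rightarrow> bool" where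
  "partially_observed_system M f a b \<sigma> d\<^sub>x d\<^sub>y W V X Y \<longleftrightarrow>
     prob_space M \<and>
     wiener_process M W \<and> wiener_process M V \<and>
     (\<forall>t\<ge>0. X t \<in> borel_measurable M) \<and> (\<forall>t\<ge>0. Y t \<in> borel_measurable M) \<and>
     distr M borel (X 0) = gaussian 0 (d\<^sub>x\<^sup>2) \<and>
     distr M borel (Y 0) = gaussian 0 (d\<^sub>y\<^sup>2) \<and>
     prob_space.indep_var M (path_space {0..}) (path_on {0..} W) (path_space {0..}) (path_on {0..} V) \<and>
     prob_space.indep_set M
       (sets (vimage_algebra (space M) (\<lambda>\<omega>. (X 0 \<omega>, Y 0 \<omega>)) (borel \<Otimes>\<^sub>M borel)))
       (sets (vimage_algebra (space M) (\<lambda>\<omega>. (path_on {0..} W \<omega>, path_on {0..} V \<omega>))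
          (path_space {0..} \<Otimes>\<^sub>M path_space {0..}))) \<and>
     (AE \<omega> in M. continuous_on {0..} (\<lambda>t. Y t \<omega>)) \<and>
     (AE \<omega> in M. \<forall>t\<ge>0. X t \<omega> = X 0 \<omega> + f * integral {0..t} (\<lambda>s. Y s \<omega>) + \<sigma> * W t \<omega>) \<and>
     (AE \<omega> in M. \<forall>t\<ge>0. Y t \<omega> = Y 0 \<omega> - a * integral {0..t} (\<lambda>s. Y s \<omega>) + b * V t \<omega>)"

definition R1 :: "nat \<Rightarrow> (real \<Rightarrow> real) \<Rightarrow> real" where
  "R1 T x = (1 / real T) * (\<Sum>k=1..T. (x (real k) - x (real (k - 1)))\<^sup>2)"

definition Psi :: "(real \<Rightarrow> real) \<Rightarrow> (real \<Rightarrow> real) \<Rightarrow> (real \<Rightarrow> real) \<Rightarrow> real \<Rightarrow> real \<Rightarrow> real" where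
  "Psi f a b \<sigma> \<theta> = (f \<theta>)\<^sup>2 * (b \<theta>)\<^sup>2 / (a \<theta>)^3 * (exp (- a \<theta>) - 1 + a \<theta>) + \<sigma>\<^sup>2"

text \<open>
  The estimator is a statistic: \<open>est T\<close> is a measurable function of the observed path
  on \<open>[0, T]\<close>, and does not depend on the true parameter. It attains the infimum over the open
  interval, at one of its points if possible and at an endpoint otherwise.
\<close>

definition moment_estimator ::
  "real \<Rightarrow> real \<Rightarrow> (real \<Rightarrow> real) \<Rightarrow> (nat \<Rightarrow> (real \<Rightarrow> real) \<Rightarrow> real) \<Rightarrow> bool" where
  "moment_estimator \<alpha> \<beta> \<Psi> est \<longleftrightarrow>
     (\<forall>T\<ge>1. est T \<in> borel_measurable (path_space {0..real T}) \<and>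
       (\<forall>x \<in> space (path_space {0..real T}).
          let m = (INF \<theta>\<in>{\<alpha><..<\<beta>}. \<bar>R1 T x - \<Psi> \<theta>\<bar>) in
            \<bar>R1 T x - \<Psi> (est T x)\<bar> = m \<and>
            est T x \<in> (if \<exists>\<theta>\<in>{\<alpha><..<\<beta>}. \<bar>R1 T x - \<Psi> \<theta>\<bar> = m then {\<alpha><..<\<beta>} else {\<alpha>, \<beta>})))"

text \<open>At the endpoints of \<open>S = [\<alpha>, \<beta>]\<close> the derivatives are one-sided.\<close>

definition twice_cont_diff_on :: "(real \<Rightarrow> real) \<Rightarrow> real set \<Rightarrow> bool" where
  "twice_cont_diff_on g S \<longleftrightarrow>
     (\<exists>g' g''. (\<forall>x\<in>S. (g has_real_derivative g' x) (at x within S)) \<and>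
               (\<forall>x\<in>S. (g' has_real_derivative g'' x) (at x within S)) \<and>
               continuous_on S g' \<and> continuous_on S g'')"

end

theory Submission
  imports Defs "HOL-Real_Asymp.Real_Asymp"
begin

text \<open>
  Since \<open>\<theta>* = est T x\<close> minimises \<open>\<bar>R1 T x - \<Psi>\<bar>\<close>, comparison with the true value \<open>\<theta>\<close> gives
  \<open>\<bar>\<Psi> \<theta>* - \<Psi> \<theta>\<bar> \<le> 2 \<bar>R1 T x - \<Psi> \<theta>\<bar>\<close>. As \<open>\<bar>\<Psi>'\<bar>\<close> is bounded below by some \<open>c > 0\<close>, the mean value
  theorem turns this into \<open>\<bar>\<theta>* - \<theta>\<bar> \<le> (2 / c) \<bar>R1 T x - \<Psi> \<theta>\<bar>\<close>. Both assertions therefore follow from one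
  estimate: for every \<open>m\<close>, the moments of order \<open>2m\<close> of \<open>T (R1 T X - \<Psi> \<theta>)\<close> are at most \<open>C T\<^sup>m\<close>, with \<open>C\<close> the
  same for all \<open>\<theta>\<close> in the open interval.

  Over the unit intervals the system is a recursion
  \<open>Y\<^sub>k\<^sub>+\<^sub>1 = q Y\<^sub>k + \<xi>\<^sub>k\<close>, \<open>X\<^sub>k\<^sub>+\<^sub>1 - X\<^sub>k = A Y\<^sub>k + \<zeta>\<^sub>k\<close>, with \<open>q = exp (- a)\<close> and \<open>A = f (1 - q) / a\<close>, in which
  \<open>(\<xi>\<^sub>k, \<zeta>\<^sub>k)\<close> is centred, Gaussian and independent of the past. With \<open>\<kappa> = A\<^sup>2 / (1 - q\<^sup>2)\<close> the term \<open>A\<^sup>2 Y\<^sub>k\<^sup>2\<close>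
  equals \<open>\<kappa> (Y\<^sub>k\<^sup>2 - q\<^sup>2 Y\<^sub>k\<^sup>2)\<close>, so that
  \<open>(X\<^sub>k\<^sub>+\<^sub>1 - X\<^sub>k)\<^sup>2 - \<Psi> = \<kappa> (Y\<^sub>k\<^sup>2 - Y\<^sub>k\<^sub>+\<^sub>1\<^sup>2) + D\<^sub>k\<close>
  where \<open>D\<^sub>k\<close> is \<open>Y\<^sub>k\<close> times a centred innovation plus \<open>\<zeta>\<^sub>k\<^sup>2 + \<kappa> \<xi>\<^sub>k\<^sup>2 - \<Psi>\<close>. The number \<open>\<Psi>\<close> is exactly
  \<open>E \<zeta>\<^sub>k\<^sup>2 + \<kappa> E \<xi>\<^sub>k\<^sup>2\<close>, hence \<open>D\<^sub>k\<close> is a martingale difference. The first part telescopes and has bounded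
  moments, and a martingale with bounded increments in every \<open>L\<^sup>p\<close> has moments of order \<open>2m\<close> growing like
  \<open>T\<^sup>m\<close> (\<open>martingale_even_moment\<close>).

  The variables \<open>\<xi>\<^sub>k\<close> and \<open>\<zeta>\<^sub>k\<close> contain Wiener integrals with respect to \<open>V\<close>. These are approximated by sums over
  a mesh of width \<open>1 / N\<close>: for fixed \<open>N\<close> the whole scheme is a function of a countable independent family
  (\<open>innovation_indep\<close>), the decomposition above and the martingale property hold for it verbatim with a
  constant \<open>\<Psi>\<^sub>N\<close> (\<open>martingale_decomposition\<close>, \<open>martingale_diff_orthogonal\<close>), and the resulting moment bound
  does not depend on \<open>N\<close> (\<open>discrete_quadratic_moment_bound\<close>). As \<open>N\<close> grows, the scheme converges path by
  path to the observed increments (\<open>discrete_increment_limit\<close>) and \<open>\<Psi>\<^sub>N\<close> tends to \<open>\<Psi>\<close> (\<open>discrete_Psi_limit\<close>),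
  so the lemma of Fatou carries the bound over to \<open>R1 T X - \<Psi> \<theta>\<close> (\<open>R1_moment_bound\<close>).

  Uniformity in \<open>\<theta>\<close>, in \<open>N\<close> and in time is kept by the predicate \<open>moments_bounded\<close>, which is stable under
  sums, products and the autoregression; the coefficients enter it only through bounds on \<open>\<bar>f\<bar>\<close>, \<open>\<bar>b\<bar>\<close> and a
  positive lower bound on \<open>a\<close>, all available on the compact interval.
\<close>

section \<open>Even moments of martingales\<close>

lemma max_power_le_sum:
  fixes x y :: real
  shows "0 \<le> x \<Longrightarrow> 0 \<le> y \<Longrightarrow> max x y ^ n \<le> x ^ n + y ^ n"
  by (simp add: max_def)

lemma mixed_power_le:
  fixes s d :: real
  assumes "j \<le> n"
  shows "\<bar>s\<bar> ^ (n - j) * \<bar>d\<bar> ^ j \<le> \<bar>s\<bar> ^ n + \<bar>d\<bar> ^ n"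
proof -
  have "\<bar>s\<bar> ^ (n - j) * \<bar>d\<bar> ^ j \<le> (max \<bar>s\<bar> \<bar>d\<bar>) ^ (n - j) * (max \<bar>s\<bar> \<bar>d\<bar>) ^ j"
    by (intro mult_mono power_mono) auto
  also have "\<dots> = (max \<bar>s\<bar> \<bar>d\<bar>) ^ n"
    using assms by (simp flip: power_add)
  also have "\<dots> \<le> \<bar>s\<bar> ^ n + \<bar>d\<bar> ^ n"
    by (rule max_power_le_sum) simp_all
  finally show ?thesis .
qed

text \<open>
  In the binomial expansion every term with at least two factors \<open>d\<close> is, up to its coefficient, at most the
  sum of the extreme ones \<open>s ^ (2*m - 2) * d\<^sup>2\<close> and \<open>d ^ (2*m)\<close>, and the binomial coefficients add up to \<open>4 ^ m\<close>. The term linear in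
  \<open>d\<close> is kept exactly because its expectation will vanish.
\<close>

lemma power_add_second_order:
  fixes s d :: real
  assumes "1 \<le> m"
  shows "(s + d) ^ (2*m)
    \<le> s ^ (2*m) + 2 * real m * s ^ (2*m - 1) * d + 4 ^ m * (s ^ (2*m - 2) * d\<^sup>2 + d ^ (2*m))"
proof -
  obtain l where l: "m = Suc l" using assms by (cases m) auto
  define t where "t k = real (2*m choose k) * d ^ k * s ^ (2*m - k)" for k
  define B where "B = s ^ (2*m - 2) * d\<^sup>2 + d ^ (2*m)"
  have B0: "0 \<le> B"
    unfolding B_def by (intro add_nonneg_nonneg mult_nonneg_nonneg zero_le_even_power) auto
  have tail: "t k \<le> real (2*m choose k) * B" if k: "k \<in> {2..2*m}" for k
  proof -
    define j where "j = k - 2"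
    then have j: "k = j + 2" "j \<le> 2*l" "2*m - k = 2*l - j"
      using k l by auto
    have "d ^ k * s ^ (2*m - k) \<le> \<bar>d ^ k * s ^ (2*m - k)\<bar>" by simp
    also have "\<dots> = d\<^sup>2 * (\<bar>s\<bar> ^ (2*l - j) * \<bar>d\<bar> ^ j)"
      unfolding j(3) by (simp add: j(1) abs_mult power_abs power_add power2_eq_square[of d])
    also have "\<dots> \<le> d\<^sup>2 * (\<bar>s\<bar> ^ (2*l) + \<bar>d\<bar> ^ (2*l))"
      using mixed_power_le[OF j(2)] by (intro mult_left_mono) auto
    also have "\<dots> = B"
      by (simp add: B_def l power_even_abs algebra_simps power2_eq_square)
    finally show ?thesis
      unfolding t_def by (metis mult.assoc mult_left_mono of_nat_0_le_iff)
  qed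
  have "(s + d) ^ (2*m) = (\<Sum>k\<le>2*m. t k)"
    unfolding add.commute[of s d] binomial_ring t_def by simp
  also have "{..2*m} = {0,1} \<union> {2..2*m}"
    using l by auto
  also have "(\<Sum>k\<in>{0,1}\<union>{2..2*m}. t k) = t 0 + t 1 + (\<Sum>k\<in>{2..2*m}. t k)"
    by (subst sum.union_disjoint) auto
  also have "(\<Sum>k\<in>{2..2*m}. t k) \<le> (\<Sum>k\<in>{2..2*m}. real (2*m choose k) * B)"
    by (intro sum_mono tail)
  also have "\<dots> \<le> (\<Sum>k\<le>2*m. real (2*m choose k) * B)"
    by (intro sum_mono2) (auto simp: B0)
  also have "\<dots> = 4 ^ m * B"
    using choose_row_sum[of "2*m"]
    by (simp add: power_mult flip: sum_distrib_right of_nat_sum)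
  finally show ?thesis
    by (simp add: t_def B_def algebra_simps)
qed

text \<open>
  Either \<open>y\<close> is small compared with \<open>x / n\<close>, or \<open>x\<close> is at most \<open>n * y\<close>. The weight \<open>n\<close> is meant to be the
  number of steps of a sum, so that the first term costs a factor \<open>1 + O(1 / n)\<close> per step.
\<close>

lemma young_power:
  fixes x y n :: real
  assumes "0 \<le> x" "0 \<le> y" "0 < n"
  shows "x ^ l * y \<le> x ^ Suc l / n + n ^ l * y ^ Suc l"
proof (cases "y \<le> x / n")
  case True
  then have "x ^ l * y \<le> x ^ l * (x / n)"
    using assms by (intro mult_left_mono) auto
  also have "\<dots> = x ^ Suc l / n" by simp
  finally show ?thesis using assms by (smt (verit) mult_nonneg_nonneg zero_le_power)
next
  case False
  then have "x \<le> n * y"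
    using assms by (simp add: field_simps)
  then have "x ^ l * y \<le> (n * y) ^ l * y"
    using assms by (intro mult_right_mono power_mono) auto
  also have "\<dots> = n ^ l * y ^ Suc l"
    by (simp add: power_mult_distrib)
  finally show ?thesis using assms
    by (smt (verit) divide_nonneg_nonneg zero_le_power)
qed

lemma power_add_martingale_step:
  fixes s d n :: real
  assumes m: "1 \<le> m" and n: "1 \<le> n"
  shows "(s + d) ^ (2*m) \<le> (1 + 4 ^ m / n) * s ^ (2*m) + 2 * real m * (s ^ (2*m - 1) * d)
           + 2 * 4 ^ m * n ^ (m - 1) * d ^ (2*m)"
proof -
  obtain l where l: "m = Suc l" using assms by (cases m) auto
  have "s ^ (2*m - 2) * d\<^sup>2 \<le> s ^ (2*m) / n + n ^ l * d ^ (2*m)"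
    using young_power[of "s\<^sup>2" "d\<^sup>2" n l] n unfolding power_mult[symmetric] by (simp add: l)
  moreover have "d ^ (2*m) \<le> n ^ l * d ^ (2*m)"
    using mult_right_mono[OF one_le_power[OF n, of l] zero_le_even_power[of "2*m" d]] by simp
  ultimately have "s ^ (2*m - 2) * d\<^sup>2 + d ^ (2*m) \<le> s ^ (2*m) / n + 2 * (n ^ l * d ^ (2*m))"
    by linarith
  then have "4 ^ m * (s ^ (2*m - 2) * d\<^sup>2 + d ^ (2*m)) \<le> 4 ^ m * (s ^ (2*m) / n + 2 * (n ^ l * d ^ (2*m)))"
    by (intro mult_left_mono) auto
  then show ?thesis
    using power_add_second_order[OF m, of s d] by (simp add: l algebra_simps)
qed

text \<open>
  The linear term of the second-order expansion has mean zero, so one step multiplies the moment by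
  \<open>1 + 4 ^ m / n\<close> and adds a term of order \<open>n ^ (m - 1)\<close>; after \<open>n\<close> steps the product of the factors is at
  most \<open>exp (4 ^ m)\<close> and the sum is of order \<open>n ^ m\<close>. This is an elementary form of the Burkholder
  inequality, in which orthogonality to the single power \<open>S ^ (2*m - 1)\<close> replaces the martingale property.
\<close>

lemma (in prob_space) martingale_even_moment:
  fixes S D :: "nat \<Rightarrow> 'a \<Rightarrow> real"
  assumes m: "1 \<le> m"
    and S_0: "\<And>\<omega>. S 0 \<omega> = 0" and S_Suc: "\<And>k \<omega>. S (Suc k) \<omega> = S k \<omega> + D k \<omega>"
    and int_S: "\<And>k. integrable M (\<lambda>\<omega>. S k \<omega> ^ (2*m))"
    and int_D: "\<And>k. integrable M (\<lambda>\<omega>. D k \<omega> ^ (2*m))"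
    and int_SD: "\<And>k. integrable M (\<lambda>\<omega>. S k \<omega> ^ (2*m - 1) * D k \<omega>)"
    and orth: "\<And>k. k < n \<Longrightarrow> expectation (\<lambda>\<omega>. S k \<omega> ^ (2*m - 1) * D k \<omega>) = 0"
    and D_le: "\<And>k. k < n \<Longrightarrow> expectation (\<lambda>\<omega>. D k \<omega> ^ (2*m)) \<le> K"
  shows "expectation (\<lambda>\<omega>. S n \<omega> ^ (2*m)) \<le> 2 * 4 ^ m * exp (4 ^ m) * K * real n ^ m"
proof (cases "n = 0")
  case True
  then show ?thesis using m by (simp add: S_0 power_0_left)
next
  case False
  then have n: "1 \<le> real n" by simp
  define r where "r = 1 + 4 ^ m / real n"
  define L where "L = 2 * 4 ^ m * real n ^ (m - 1) * K"
  have r: "1 \<le> r" by (simp add: r_def)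
  have "0 \<le> expectation (\<lambda>\<omega>. D 0 \<omega> ^ (2*m))"
    by (intro integral_nonneg_AE) (auto simp: power_mult)
  then have K: "0 \<le> K" using D_le[of 0] False by (metis gr0I order_trans)
  then have L: "0 \<le> L" by (simp add: L_def)
  \<comment> \<open>\<open>n\<close> serves as the weight in every step, also in those before the last one.\<close>
  have step: "expectation (\<lambda>\<omega>. S (Suc k) \<omega> ^ (2*m)) \<le> r * expectation (\<lambda>\<omega>. S k \<omega> ^ (2*m)) + L"
    if k: "k < n" for k
  proof -
    have "expectation (\<lambda>\<omega>. S (Suc k) \<omega> ^ (2*m))
       \<le> expectation (\<lambda>\<omega>. r * S k \<omega> ^ (2*m) + 2 * real m * (S k \<omega> ^ (2*m - 1) * D k \<omega>)
           + 2 * 4 ^ m * real n ^ (m - 1) * D k \<omega> ^ (2*m))"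
      using power_add_martingale_step[OF m n]
      by (intro integral_mono int_S Bochner_Integration.integrable_add integrable_mult_right int_D int_SD)
         (simp add: S_Suc r_def)
    also have "\<dots> = r * expectation (\<lambda>\<omega>. S k \<omega> ^ (2*m))
        + 2 * real m * expectation (\<lambda>\<omega>. S k \<omega> ^ (2*m - 1) * D k \<omega>)
           + 2 * 4 ^ m * real n ^ (m - 1) * expectation (\<lambda>\<omega>. D k \<omega> ^ (2*m))"
      by (subst Bochner_Integration.integral_add; (intro int_S Bochner_Integration.integrable_add integrable_mult_right int_D int_SD)?)+
         simp
    also have "\<dots> \<le> r * expectation (\<lambda>\<omega>. S k \<omega> ^ (2*m)) + 0 + L"
      unfolding L_def orth[OF k] using D_le[OF k] r by (intro add_mono mult_left_mono) auto
    finally show ?thesis by simp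
  qed
  have "expectation (\<lambda>\<omega>. S k \<omega> ^ (2*m)) \<le> real k * r ^ k * L" if "k \<le> n" for k
    using that
  proof (induction k)
    case 0
    then show ?case using m by (simp add: S_0 power_0_left)
  next
    case (Suc k)
    have "expectation (\<lambda>\<omega>. S (Suc k) \<omega> ^ (2*m)) \<le> r * expectation (\<lambda>\<omega>. S k \<omega> ^ (2*m)) + L"
      using Suc.prems by (intro step) simp
    also have "\<dots> \<le> r * (real k * r ^ k * L) + L"
      using Suc r by (intro add_mono mult_left_mono) auto
    also have "\<dots> \<le> r * (real k * r ^ k * L) + r ^ Suc k * L"
      using r L one_le_power[OF r, of "Suc k"] mult_right_mono[of 1 "r ^ Suc k" L] by simp
    also have "\<dots> = real (Suc k) * r ^ Suc k * L"
      by (simp add: algebra_simps)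
    finally show ?case .
  qed
  from this[of n] have "expectation (\<lambda>\<omega>. S n \<omega> ^ (2*m)) \<le> real n * r ^ n * L" by simp
  also have "r ^ n \<le> exp (4 ^ m)"
    unfolding r_def using False by (intro exp_ge_one_plus_x_over_n_power_n) (auto intro: order_trans[of _ 0])
  then have "real n * r ^ n * L \<le> real n * exp (4 ^ m) * L"
    using L by (intro mult_right_mono mult_left_mono) auto
  also have "\<dots> = 2 * 4 ^ m * exp (4 ^ m) * K * real n ^ m"
    using m by (cases m) (auto simp: L_def)
  finally show ?thesis .
qed

section \<open>Families with uniformly bounded moments\<close>

text \<open>
  The bounds may depend on the order of the moment but not on the index \<open>i\<close>, and each \<open>i\<close> may have its own
  probability space. Even orders suffice, since they dominate all others, and avoid absolute values.
\<close>

definition moments_bounded :: "'i set \<Rightarrow> ('i \<Rightarrow> 'a measure) \<Rightarrow> ('i \<Rightarrow> 'a \<Rightarrow> real) \<Rightarrow> bool" where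
  "moments_bounded I M Z \<longleftrightarrow>
     (\<forall>i\<in>I. Z i \<in> borel_measurable (M i)) \<and>
     (\<forall>m. \<exists>C. \<forall>i\<in>I. integrable (M i) (\<lambda>\<omega>. Z i \<omega> ^ (2*m)) \<and>
                      (\<integral>\<omega>. Z i \<omega> ^ (2*m) \<partial>M i) \<le> C)"

lemma moments_boundedI:
  assumes "\<And>i. i \<in> I \<Longrightarrow> Z i \<in> borel_measurable (M i)"
    and "\<And>m i. i \<in> I \<Longrightarrow> integrable (M i) (\<lambda>\<omega>. Z i \<omega> ^ (2*m))"
    and "\<And>m i. i \<in> I \<Longrightarrow> (\<integral>\<omega>. Z i \<omega> ^ (2*m) \<partial>M i) \<le> C m"
  shows "moments_bounded I M Z"
  unfolding moments_bounded_def using assms by blast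

lemma moments_bounded_measurable:
  "moments_bounded I M Z \<Longrightarrow> i \<in> I \<Longrightarrow> Z i \<in> borel_measurable (M i)"
  by (simp add: moments_bounded_def)

lemma moments_bounded_integrable_even:
  "moments_bounded I M Z \<Longrightarrow> i \<in> I \<Longrightarrow> integrable (M i) (\<lambda>\<omega>. Z i \<omega> ^ (2*m))"
  by (fastforce simp add: moments_bounded_def)

lemma moments_boundedE:
  assumes "moments_bounded I M Z"
  obtains C where "0 \<le> C" "\<And>i. i \<in> I \<Longrightarrow> (\<integral>\<omega>. Z i \<omega> ^ (2*m) \<partial>M i) \<le> C"
proof -
  from assms obtain C where "\<forall>i\<in>I. integrable (M i) (\<lambda>\<omega>. Z i \<omega> ^ (2*m)) \<and>
       (\<integral>\<omega>. Z i \<omega> ^ (2*m) \<partial>M i) \<le> C"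
    unfolding moments_bounded_def by metis
  then show ?thesis
    by (intro that[of "max 0 C"]) auto
qed

lemma moments_bounded_reindex:
  assumes "moments_bounded I M Z" and "\<And>j. j \<in> J \<Longrightarrow> h j \<in> I"
  shows "moments_bounded J (\<lambda>j. M (h j)) (\<lambda>j. Z (h j))"
  unfolding moments_bounded_def
proof (intro conjI ballI allI)
  fix m
  obtain C where C: "\<And>i. i \<in> I \<Longrightarrow> (\<integral>\<omega>. Z i \<omega> ^ (2*m) \<partial>M i) \<le> C"
    using moments_boundedE[OF assms(1)] by metis
  then show "\<exists>C. \<forall>i\<in>J. integrable (M (h i)) (\<lambda>\<omega>. Z (h i) \<omega> ^ (2*m)) \<and> (\<integral>\<omega>. Z (h i) \<omega> ^ (2*m) \<partial>M (h i)) \<le> C"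
    using assms(2) moments_bounded_integrable_even[OF assms(1)] by blast
qed (use assms in \<open>auto dest: moments_bounded_measurable\<close>)

lemma moments_bounded_const:
  assumes "\<And>i. i \<in> I \<Longrightarrow> prob_space (M i)" and "\<And>i. i \<in> I \<Longrightarrow> \<bar>r i\<bar> \<le> R"
  shows "moments_bounded I M (\<lambda>i \<omega>. r i)"
proof (rule moments_boundedI)
  fix m i assume i: "i \<in> I"
  interpret prob_space "M i" using assms(1) i .
  show "integrable (M i) (\<lambda>\<omega>. r i ^ (2*m))" by simp
  show "(\<integral>\<omega>. r i ^ (2*m) \<partial>M i) \<le> R ^ (2*m)"
    using power_mono[OF assms(2)[OF i], of "2*m"] by (simp add: power_even_abs prob_space)
qed simp

lemma even_power_sum_le:
  fixes x y :: real
  shows "(x + y) ^ (2*m) \<le> 4 ^ m * (x ^ (2*m) + y ^ (2*m))"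
proof -
  have "(x + y) ^ (2*m) = \<bar>x + y\<bar> ^ (2*m)" by (simp add: power_even_abs)
  also have "\<dots> \<le> (2 * max \<bar>x\<bar> \<bar>y\<bar>) ^ (2*m)"
    by (intro power_mono) auto
  also have "\<dots> = 4 ^ m * max \<bar>x\<bar> \<bar>y\<bar> ^ (2*m)"
    by (simp add: power_mult_distrib power_mult)
  also have "\<dots> \<le> 4 ^ m * (\<bar>x\<bar> ^ (2*m) + \<bar>y\<bar> ^ (2*m))"
    using max_power_le_sum[of "\<bar>x\<bar>" "\<bar>y\<bar>" "2*m"] by (intro mult_left_mono) auto
  finally show ?thesis by (simp add: power_even_abs)
qed

lemma moments_bounded_add:
  assumes Z: "moments_bounded I M Z" and U: "moments_bounded I M U"
  shows "moments_bounded I M (\<lambda>i \<omega>. Z i \<omega> + U i \<omega>)"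
  unfolding moments_bounded_def
proof (intro conjI ballI allI)
  fix m
  note int = moments_bounded_integrable_even[OF Z, where m = m] moments_bounded_integrable_even[OF U, where m = m]
  note meas[measurable] = moments_bounded_measurable[OF Z] moments_bounded_measurable[OF U]
  obtain C D where C: "\<And>i. i \<in> I \<Longrightarrow> (\<integral>\<omega>. Z i \<omega> ^ (2*m) \<partial>M i) \<le> C"
    and D: "\<And>i. i \<in> I \<Longrightarrow> (\<integral>\<omega>. U i \<omega> ^ (2*m) \<partial>M i) \<le> D"
    using moments_boundedE[OF Z] moments_boundedE[OF U] by metis
  show "\<exists>E. \<forall>i\<in>I. integrable (M i) (\<lambda>\<omega>. (Z i \<omega> + U i \<omega>) ^ (2*m)) \<and>
      (\<integral>\<omega>. (Z i \<omega> + U i \<omega>) ^ (2*m) \<partial>M i) \<le> E"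
  proof (intro exI[of _ "4 ^ m * (C + D)"] ballI conjI)
    fix i assume i: "i \<in> I"
    show I: "integrable (M i) (\<lambda>\<omega>. (Z i \<omega> + U i \<omega>) ^ (2*m))"
    proof (rule Bochner_Integration.integrable_bound)
      show "integrable (M i) (\<lambda>\<omega>. 4 ^ m * (Z i \<omega> ^ (2*m) + U i \<omega> ^ (2*m)))"
        using int[OF i] by auto
      show "AE \<omega> in M i. norm ((Z i \<omega> + U i \<omega>) ^ (2*m)) \<le> norm (4 ^ m * (Z i \<omega> ^ (2*m) + U i \<omega> ^ (2*m)))"
        using even_power_sum_le[where m = m] by (intro AE_I2) (auto simp: zero_le_even_power intro: order_trans[OF _ abs_ge_self])
    qed (use i in measurable)
    have "(\<integral>\<omega>. (Z i \<omega> + U i \<omega>) ^ (2*m) \<partial>M i) \<le> (\<integral>\<omega>. 4 ^ m * (Z i \<omega> ^ (2*m) + U i \<omega> ^ (2*m)) \<partial>M i)"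
      using int[OF i] by (intro integral_mono I even_power_sum_le) auto
    also have "\<dots> = 4 ^ m * ((\<integral>\<omega>. Z i \<omega> ^ (2*m) \<partial>M i) + (\<integral>\<omega>. U i \<omega> ^ (2*m) \<partial>M i))"
      using int[OF i] by simp
    also have "\<dots> \<le> 4 ^ m * (C + D)"
      using C[OF i] D[OF i] by (intro mult_left_mono add_mono) auto
    finally show "(\<integral>\<omega>. (Z i \<omega> + U i \<omega>) ^ (2*m) \<partial>M i) \<le> 4 ^ m * (C + D)" .
  qed
qed (intro borel_measurable_add moments_bounded_measurable[OF Z] moments_bounded_measurable[OF U])

lemma even_power_prod_le:
  fixes x y :: real
  shows "(x * y) ^ (2*m) \<le> x ^ (2*(2*m)) + y ^ (2*(2*m))"
proof -
  have "0 \<le> x ^ (2*m) * y ^ (2*m)"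
    by (intro mult_nonneg_nonneg zero_le_even_power) auto
  moreover have "(x * y) ^ (2*m) = x ^ (2*m) * y ^ (2*m)"
    by (simp add: power_mult_distrib)
  ultimately have "(x * y) ^ (2*m) \<le> (x ^ (2*m))\<^sup>2 + (y ^ (2*m))\<^sup>2"
    using sum_squares_bound[of "x ^ (2*m)" "y ^ (2*m)"] by linarith
  then show ?thesis by (simp add: mult.commute flip: power_mult)
qed

lemma moments_bounded_mult:
  assumes Z: "moments_bounded I M Z" and U: "moments_bounded I M U"
  shows "moments_bounded I M (\<lambda>i \<omega>. Z i \<omega> * U i \<omega>)"
  unfolding moments_bounded_def
proof (intro conjI ballI allI)
  fix m
  note int = moments_bounded_integrable_even[OF Z, where m = "2*m"] moments_bounded_integrable_even[OF U, where m = "2*m"]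
  note meas[measurable] = moments_bounded_measurable[OF Z] moments_bounded_measurable[OF U]
  obtain C D where C: "\<And>i. i \<in> I \<Longrightarrow> (\<integral>\<omega>. Z i \<omega> ^ (2*(2*m)) \<partial>M i) \<le> C"
    and D: "\<And>i. i \<in> I \<Longrightarrow> (\<integral>\<omega>. U i \<omega> ^ (2*(2*m)) \<partial>M i) \<le> D"
    using moments_boundedE[OF Z] moments_boundedE[OF U] by metis
  show "\<exists>E. \<forall>i\<in>I. integrable (M i) (\<lambda>\<omega>. (Z i \<omega> * U i \<omega>) ^ (2*m)) \<and>
      (\<integral>\<omega>. (Z i \<omega> * U i \<omega>) ^ (2*m) \<partial>M i) \<le> E"
  proof (intro exI[of _ "C + D"] ballI conjI)
    fix i assume i: "i \<in> I"
    show I: "integrable (M i) (\<lambda>\<omega>. (Z i \<omega> * U i \<omega>) ^ (2*m))"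
    proof (rule Bochner_Integration.integrable_bound)
      show "integrable (M i) (\<lambda>\<omega>. Z i \<omega> ^ (2*(2*m)) + U i \<omega> ^ (2*(2*m)))"
        using int[OF i] by (intro Bochner_Integration.integrable_add)
      show "AE \<omega> in M i. norm ((Z i \<omega> * U i \<omega>) ^ (2*m)) \<le> norm (Z i \<omega> ^ (2*(2*m)) + U i \<omega> ^ (2*(2*m)))"
        using even_power_prod_le[where m = m] by (intro AE_I2) (auto simp: zero_le_even_power intro: order_trans[OF _ abs_ge_self])
    qed (use i in measurable)
    have "(\<integral>\<omega>. (Z i \<omega> * U i \<omega>) ^ (2*m) \<partial>M i) \<le> (\<integral>\<omega>. Z i \<omega> ^ (2*(2*m)) + U i \<omega> ^ (2*(2*m)) \<partial>M i)"
      using int[OF i] by (intro integral_mono I even_power_prod_le Bochner_Integration.integrable_add)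
    also have "\<dots> = (\<integral>\<omega>. Z i \<omega> ^ (2*(2*m)) \<partial>M i) + (\<integral>\<omega>. U i \<omega> ^ (2*(2*m)) \<partial>M i)"
      using int[OF i] by (rule Bochner_Integration.integral_add)
    also have "\<dots> \<le> C + D"
      using C[OF i] D[OF i] by (intro add_mono) auto
    finally show "(\<integral>\<omega>. (Z i \<omega> * U i \<omega>) ^ (2*m) \<partial>M i) \<le> C + D" .
  qed
qed (intro borel_measurable_times moments_bounded_measurable[OF Z] moments_bounded_measurable[OF U])

lemma moments_bounded_power:
  assumes "\<And>i. i \<in> I \<Longrightarrow> prob_space (M i)" and "moments_bounded I M Z"
  shows "moments_bounded I M (\<lambda>i \<omega>. Z i \<omega> ^ n)"
proof (induction n)
  case 0
  show ?case using moments_bounded_const[of I M "\<lambda>_. 1" 1] assms(1) by simp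
next
  case (Suc n)
  then show ?case using moments_bounded_mult[OF assms(2)] by simp
qed

lemma moments_bounded_integrable:
  assumes "moments_bounded I M Z" and i: "i \<in> I" and "prob_space (M i)"
  shows "integrable (M i) (Z i)"
proof -
  interpret prob_space "M i" by fact
  have "integrable (M i) (\<lambda>\<omega>. 1 + Z i \<omega> ^ 2)"
    using moments_bounded_integrable_even[OF assms(1) i, of 1] by auto
  then show ?thesis
  proof (rule Bochner_Integration.integrable_bound)
    have "\<bar>z\<bar> \<le> 1 + z\<^sup>2" for z :: real
      using zero_le_power2[of "\<bar>z\<bar> - 1"] unfolding power2_diff by simp
    then show "AE \<omega> in M i. norm (Z i \<omega>) \<le> norm (1 + Z i \<omega> ^ 2)"
      unfolding real_norm_def by (intro AE_I2 order_trans[OF _ abs_ge_self])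
  qed (rule moments_bounded_measurable[OF assms(1) i])
qed

lemma convex_combination_even_power:
  fixes x y q :: real
  assumes "0 \<le> q" "q \<le> 1"
  shows "(q * x + (1 - q) * y) ^ (2*m) \<le> q * x ^ (2*m) + (1 - q) * y ^ (2*m)"
proof -
  have "convex_on UNIV (\<lambda>x::real. x ^ (2*m))"
    by (rule convex_power_even) simp
  from convex_onD[OF this, of "1 - q" x y] show ?thesis using assms by simp
qed

text \<open>
  Writing \<open>q * y + \<xi> = q * y + (1 - q) * (\<xi> / (1 - q))\<close> shows the next value as a convex combination, so by
  convexity of even powers the moment of the next value is at most the larger of the moments of \<open>y\<close> and of
  \<open>\<xi> / (1 - q)\<close>. A common bound for both is therefore preserved in time.
\<close>

lemma moments_bounded_autoregression:
  assumes prob: "\<And>i. i \<in> I \<Longrightarrow> prob_space (M i)"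
    and Y_0: "moments_bounded I M (\<lambda>i. Y i 0)"
    and noise: "moments_bounded (I \<times> UNIV) (\<lambda>x. M (fst x)) (\<lambda>x. \<xi> (fst x) (snd x))"
    and Y_Suc: "\<And>i k \<omega>. i \<in> I \<Longrightarrow> Y i (Suc k) \<omega> = q i * Y i k \<omega> + \<xi> i k \<omega>"
    and q: "\<And>i. i \<in> I \<Longrightarrow> 0 \<le> q i" "\<And>i. i \<in> I \<Longrightarrow> q i \<le> q\<^sub>0" and "q\<^sub>0 < 1"
  shows "moments_bounded (I \<times> UNIV) (\<lambda>x. M (fst x)) (\<lambda>x. Y (fst x) (snd x))"
proof -
  have meas: "Y i k \<in> borel_measurable (M i)" if i: "i \<in> I" for i k
  proof (induction k)
    case 0
    show ?case using moments_bounded_measurable[OF Y_0 i] .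
  next
    case (Suc k)
    then show ?case
      using moments_bounded_measurable[OF noise, of "(i, k)"] i
      by (subst measurable_cong[OF Y_Suc[OF i]]) auto
  qed
  show ?thesis
    unfolding moments_bounded_def
  proof (intro conjI ballI allI)
    fix m
    obtain C\<^sub>0 where C0: "0 \<le> C\<^sub>0" "\<And>i. i \<in> I \<Longrightarrow> (\<integral>\<omega>. Y i 0 \<omega> ^ (2*m) \<partial>M i) \<le> C\<^sub>0"
      using moments_boundedE[OF Y_0] by metis
    obtain C\<^sub>1 where C1: "0 \<le> C\<^sub>1"
      and "\<And>x. x \<in> I \<times> UNIV \<Longrightarrow> (\<integral>\<omega>. \<xi> (fst x) (snd x) \<omega> ^ (2*m) \<partial>M (fst x)) \<le> C\<^sub>1"
      using moments_boundedE[OF noise, of m] by metis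
    from this(2)[of "(i, k)" for i k]
    have \<xi>_le: "(\<integral>\<omega>. \<xi> i k \<omega> ^ (2*m) \<partial>M i) \<le> C\<^sub>1" if "i \<in> I" for i k
      using that by simp
    define C where "C = C\<^sub>0 + C\<^sub>1 / (1 - q\<^sub>0) ^ (2*m)"
    have "integrable (M i) (\<lambda>\<omega>. Y i k \<omega> ^ (2*m)) \<and> (\<integral>\<omega>. Y i k \<omega> ^ (2*m) \<partial>M i) \<le> C"
      if i: "i \<in> I" for i k
    proof (induction k)
      case 0
      show ?case
        using moments_bounded_integrable_even[OF Y_0 i] C0(2)[OF i] C1 \<open>q\<^sub>0 < 1\<close>
        by (auto simp: C_def intro: add_increasing2)
    next
      case (Suc k)
      have int\<xi>: "integrable (M i) (\<lambda>\<omega>. \<xi> i k \<omega> ^ (2*m))"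
        using moments_bounded_integrable_even[OF noise, of "(i, k)"] i by auto
      have q1: "0 \<le> q i" "q i < 1" "q i \<le> q\<^sub>0"
        using q[OF i] \<open>q\<^sub>0 < 1\<close> by auto
      have pw: "Y i (Suc k) \<omega> ^ (2*m) \<le> q i * Y i k \<omega> ^ (2*m) + (1 - q i) * (\<xi> i k \<omega> ^ (2*m) / (1 - q\<^sub>0) ^ (2*m))" for \<omega>
      proof -
        have "Y i (Suc k) \<omega> ^ (2*m) = (q i * Y i k \<omega> + (1 - q i) * (\<xi> i k \<omega> / (1 - q i))) ^ (2*m)"
          using q1 by (simp add: Y_Suc[OF i])
        also have "\<dots> \<le> q i * Y i k \<omega> ^ (2*m) + (1 - q i) * (\<xi> i k \<omega> / (1 - q i)) ^ (2*m)"
          using q1 by (intro convex_combination_even_power) auto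
        also have "(\<xi> i k \<omega> / (1 - q i)) ^ (2*m) \<le> \<xi> i k \<omega> ^ (2*m) / (1 - q\<^sub>0) ^ (2*m)"
          unfolding power_divide using q1 \<open>q\<^sub>0 < 1\<close>
          by (intro divide_left_mono power_mono mult_pos_pos) (auto simp: zero_le_even_power)
        finally show ?thesis using q1 by (simp add: mult_left_mono)
      qed
      have intR: "integrable (M i) (\<lambda>\<omega>. q i * Y i k \<omega> ^ (2*m) + (1 - q i) * (\<xi> i k \<omega> ^ (2*m) / (1 - q\<^sub>0) ^ (2*m)))"
        using Suc int\<xi> by auto
      have I: "integrable (M i) (\<lambda>\<omega>. Y i (Suc k) \<omega> ^ (2*m))"
        using meas[OF i, of "Suc k"]
        by (intro Bochner_Integration.integrable_bound[OF intR] AE_I2)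
           (auto simp: zero_le_even_power intro!: order_trans[OF pw])
      have "(\<integral>\<omega>. Y i (Suc k) \<omega> ^ (2*m) \<partial>M i)
          \<le> q i * (\<integral>\<omega>. Y i k \<omega> ^ (2*m) \<partial>M i) + (1 - q i) * ((\<integral>\<omega>. \<xi> i k \<omega> ^ (2*m) \<partial>M i) / (1 - q\<^sub>0) ^ (2*m))"
        using integral_mono[OF I intR pw] Suc int\<xi> by simp
      also have "\<dots> \<le> q i * C + (1 - q i) * C"
      proof (intro add_mono mult_left_mono)
        show "(\<integral>\<omega>. \<xi> i k \<omega> ^ (2*m) \<partial>M i) / (1 - q\<^sub>0) ^ (2*m) \<le> C"
          using \<xi>_le[OF i, of k] C0(1) \<open>q\<^sub>0 < 1\<close>
          by (simp add: C_def divide_right_mono add_increasing)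
      qed (use Suc q1 in auto)
      finally show ?case using I by (simp add: algebra_simps)
    qed
    then show "\<exists>C. \<forall>x\<in>I \<times> UNIV. integrable (M (fst x)) (\<lambda>\<omega>. Y (fst x) (snd x) \<omega> ^ (2*m)) \<and>
       (\<integral>\<omega>. Y (fst x) (snd x) \<omega> ^ (2*m) \<partial>M (fst x)) \<le> C"
      by (intro exI[of _ C]) auto
  qed (auto simp: meas)
qed

lemma (in prob_space) normal_even_moment:
  assumes "0 < s" and D: "distributed M lborel Z (normal_density 0 s)"
  shows "integrable M (\<lambda>\<omega>. Z \<omega> ^ (2*m))"
    and "expectation (\<lambda>\<omega>. Z \<omega> ^ (2*m)) = fact (2*m) / (2 ^ m * fact m) * s ^ (2*m)"
proof -
  note * = normal_moment_even[OF \<open>0 < s\<close>, of 0 m]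
  show "integrable M (\<lambda>\<omega>. Z \<omega> ^ (2*m))"
    using distributed_integrable[OF D, of "\<lambda>x. x ^ (2*m)"] integrable.intros[OF *] by simp
  show "expectation (\<lambda>\<omega>. Z \<omega> ^ (2*m)) = fact (2*m) / (2 ^ m * fact m) * s ^ (2*m)"
    using distributed_integral[OF D, of "\<lambda>x. x ^ (2*m)"] has_bochner_integral_integral_eq[OF *]
    by (simp add: power_divide power_mult)
qed

lemma moments_bounded_normal:
  assumes prob: "\<And>i. i \<in> I \<Longrightarrow> prob_space (M i)"
    and D: "\<And>i. i \<in> I \<Longrightarrow> distributed (M i) lborel (Z i) (normal_density 0 (s i))"
    and s: "\<And>i. i \<in> I \<Longrightarrow> 0 < s i" "\<And>i. i \<in> I \<Longrightarrow> s i \<le> R"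
  shows "moments_bounded I M Z"
proof (rule moments_boundedI)
  fix i m assume i: "i \<in> I"
  interpret prob_space "M i" using prob i .
  show "Z i \<in> borel_measurable (M i)"
    using distributed_measurable[OF D[OF i]] by simp
  note mom = normal_even_moment[OF s(1)[OF i] D[OF i], where m = m]
  show "integrable (M i) (\<lambda>\<omega>. Z i \<omega> ^ (2*m))" by (fact mom)
  show "(\<integral>\<omega>. Z i \<omega> ^ (2*m) \<partial>M i) \<le> fact (2*m) / (2 ^ m * fact m) * R ^ (2*m)"
    unfolding mom(2) using s[OF i] by (intro mult_left_mono power_mono) auto
qed

section \<open>Independent innovations\<close>

text \<open>
  Serves to assemble independence of the initial value and of the two noises, which comes from two different
  sources: within one noise from its increments, across them from the independence of two sigma-algebras.
\<close>

lemma (in prob_space) indep_vars_Un: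
  assumes I: "indep_vars M' X I" and J: "indep_vars M' X J"
    and AB: "indep_set \<A> \<B>" and stable: "Int_stable \<A>" "Int_stable \<B>"
    and inA: "\<And>i E. i \<in> I \<Longrightarrow> E \<in> sets (M' i) \<Longrightarrow> X i -` E \<inter> space M \<in> \<A>"
    and inB: "\<And>i E. i \<in> J \<Longrightarrow> E \<in> sets (M' i) \<Longrightarrow> X i -` E \<inter> space M \<in> \<B>"
  shows "indep_vars M' X (I \<union> J)"
  unfolding indep_vars_def2
proof (intro conjI ballI)
  let ?F = "\<lambda>i. {X i -` E \<inter> space M | E. E \<in> sets (M' i)}"
  have IF: "indep_sets ?F I" and JF: "indep_sets ?F J"
    using I J unfolding indep_vars_def2 by auto
  show "random_variable (M' i) (X i)" if "i \<in> I \<union> J" for i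
    using that I J unfolding indep_vars_def2 by auto
  have INT_in: "(\<Inter>i\<in>K. E i) \<in> \<C>"
    if "finite K" "K \<noteq> {}" "Int_stable \<C>" "\<And>i. i \<in> K \<Longrightarrow> E i \<in> \<C>" for K \<C> and E :: "'b \<Rightarrow> 'a set"
    using that by (induction rule: finite_ne_induct) (auto simp: Int_stable_def)
  show "indep_sets ?F (I \<union> J)"
  proof (rule indep_setsI)
    fix i assume "i \<in> I \<union> J"
    then show "?F i \<subseteq> events"
      using IF JF unfolding indep_sets_def by blast
  next
    fix E K assume K: "K \<noteq> {}" "K \<subseteq> I \<union> J" "finite K" and E: "\<forall>k\<in>K. E k \<in> ?F k"
    show "prob (\<Inter>k\<in>K. E k) = (\<Prod>k\<in>K. prob (E k))"
    proof (cases "K \<subseteq> I \<or> K \<subseteq> J")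
      case True
      then show ?thesis
        using K E indep_setsD[OF IF, of K E] indep_setsD[OF JF, of K E] by blast
    next
      case False
      define K1 K2 where "K1 = K \<inter> I" and "K2 = K - I"
      have K12: "K1 \<noteq> {}" "K2 \<noteq> {}" "finite K1" "finite K2" "K1 \<subseteq> I" "K2 \<subseteq> J"
        "K = K1 \<union> K2" "K1 \<inter> K2 = {}"
        using False K unfolding K1_def K2_def by auto
      have EF: "\<exists>F. E k = X k -` F \<inter> space M \<and> F \<in> sets (M' k)" if "k \<in> K1 \<union> K2" for k
        using E that K12(7) by auto
      have "E k \<in> \<A>" if "k \<in> K1" for k
        using EF[of k] inA[of k] that K12(5) by auto
      then have "(\<Inter>k\<in>K1. E k) \<in> \<A>"
        using K12 by (intro INT_in stable) simp_all
      moreover have "E k \<in> \<B>" if "k \<in> K2" for k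
        using EF[of k] inB[of k] that K12(6) by auto
      then have "(\<Inter>k\<in>K2. E k) \<in> \<B>"
        using K12 by (intro INT_in stable) simp_all
      ultimately have "prob ((\<Inter>k\<in>K1. E k) \<inter> (\<Inter>k\<in>K2. E k)) = prob (\<Inter>k\<in>K1. E k) * prob (\<Inter>k\<in>K2. E k)"
        by (rule indep_setD[OF AB])
      also have "prob (\<Inter>k\<in>K1. E k) = (\<Prod>k\<in>K1. prob (E k))"
        using K12 E by (intro indep_setsD[OF IF]) simp_all
      also have "prob (\<Inter>k\<in>K2. E k) = (\<Prod>k\<in>K2. prob (E k))"
        using K12 E by (intro indep_setsD[OF JF]) simp_all
      also have "(\<Prod>k\<in>K1. prob (E k)) * (\<Prod>k\<in>K2. prob (E k)) = (\<Prod>k\<in>K. prob (E k))"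
        using K12 by (simp add: prod.union_disjoint)
      also have "(\<Inter>k\<in>K1. E k) \<inter> (\<Inter>k\<in>K2. E k) = (\<Inter>k\<in>K. E k)"
        using K12 by auto
      finally show ?thesis .
    qed
  qed
qed

definition generated_sigma :: "'a measure \<Rightarrow> ('i \<Rightarrow> 'a \<Rightarrow> real) \<Rightarrow> 'i set \<Rightarrow> 'a measure" where
  "generated_sigma M X A = sigma (space M) (\<Union>i\<in>A. {X i -` E \<inter> space M | E. E \<in> sets borel})"

lemma space_generated_sigma [simp]: "space (generated_sigma M X A) = space M"
  by (auto simp: generated_sigma_def intro!: space_measure_of)

lemma sets_generated_sigma:
  "sets (generated_sigma M X A) = sigma_sets (space M) (\<Union>i\<in>A. {X i -` E \<inter> space M | E. E \<in> sets borel})"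
  unfolding generated_sigma_def by (rule sets_measure_of) auto

lemma measurable_generated_sigma:
  "i \<in> A \<Longrightarrow> X i \<in> borel_measurable (generated_sigma M X A)"
  by (rule measurableI) (auto simp: sets_generated_sigma intro!: sigma_sets.Basic)

lemma generated_sigma_mono:
  assumes "Z \<in> borel_measurable (generated_sigma M X A)" and "A \<subseteq> A'"
  shows "Z \<in> borel_measurable (generated_sigma M X A')"
proof -
  have "sets (generated_sigma M X A) \<subseteq> sets (generated_sigma M X A')"
    unfolding sets_generated_sigma using assms(2) by (intro sigma_sets_mono') auto
  then show ?thesis
    using assms(1) unfolding measurable_def by auto
qed

text \<open>
  Past and future of the discretised system are functions of innovations with disjoint index sets.
\<close>

lemma (in prob_space) indep_var_generated_sigma:
  fixes Z Z' :: "'a \<Rightarrow> real"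
  assumes X: "indep_vars (\<lambda>_. borel) X UNIV" and disj: "A \<inter> A' = {}"
    and Z: "Z \<in> borel_measurable (generated_sigma M X A)"
    and Z': "Z' \<in> borel_measurable (generated_sigma M X A')"
  shows "indep_var borel Z borel Z'"
proof -
  let ?F = "\<lambda>i. {X i -` E \<inter> space M | E. E \<in> sets borel}"
  have X_rv: "random_variable borel (X i)" for i
    using X unfolding indep_vars_def2 by auto
  have "indep_sets (\<lambda>j. sigma_sets (space M) (\<Union>i\<in>case_bool A A' j. ?F i)) UNIV"
  proof (rule indep_sets_collect_sigma)
    show "indep_sets ?F (\<Union>j\<in>UNIV. case_bool A A' j)"
      using X unfolding indep_vars_def2 by (auto intro: indep_sets_mono_index)
    show "Int_stable (?F i)" for i
    proof (rule Int_stableI)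
      fix a b assume "a \<in> ?F i" "b \<in> ?F i"
      then obtain E E' where "a = X i -` E \<inter> space M" "E \<in> sets borel" "b = X i -` E' \<inter> space M" "E' \<in> sets borel"
        by auto
      then show "a \<inter> b \<in> ?F i"
        by (intro CollectI exI[of _ "E \<inter> E'"]) auto
    qed
    show "disjoint_family_on (case_bool A A') UNIV"
      using disj by (auto simp: disjoint_family_on_def split: bool.split)
  qed
  then have ind: "indep_set (sets (generated_sigma M X A)) (sets (generated_sigma M X A'))"
    unfolding indep_set_def sets_generated_sigma
    by (rule indep_sets_mono_sets) (auto split: bool.split_asm)
  have rv: "U \<in> borel_measurable M" if "U \<in> borel_measurable (generated_sigma M X B)" for U :: "'a \<Rightarrow> real" and B
  proof -
    have "sets (generated_sigma M X B) \<subseteq> sets M"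
      unfolding sets_generated_sigma using X_rv
      by (intro sets.sigma_sets_subset) (auto intro: measurable_sets)
    then show ?thesis using that unfolding measurable_def by auto
  qed
  have sub: "sigma_sets (space M) {U -` E \<inter> space M | E. E \<in> sets borel} \<subseteq> sets (generated_sigma M X B)"
    if "U \<in> borel_measurable (generated_sigma M X B)" for U :: "'a \<Rightarrow> real" and B
  proof -
    have "{U -` E \<inter> space M | E. E \<in> sets borel} \<subseteq> sets (generated_sigma M X B)"
      using measurable_sets[OF that] by auto
    from sets.sigma_sets_subset[OF this] show ?thesis by simp
  qed
  show ?thesis
    unfolding indep_var_eq
  proof (intro conjI rv[OF Z] rv[OF Z'])
    show "indep_set (sigma_sets (space M) {Z -` E \<inter> space M | E. E \<in> sets borel})
                    (sigma_sets (space M) {Z' -` E \<inter> space M | E. E \<in> sets borel})"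
      unfolding indep_set_def
      by (rule indep_sets_mono_sets[OF ind[unfolded indep_set_def]])
         (use sub[OF Z] sub[OF Z'] in \<open>auto split: bool.split\<close>)
  qed
qed

text \<open>
  Independence of an infinite family only concerns its finite subfamilies, and these lie in an initial segment
  of the partition.
\<close>

lemma (in prob_space) wiener_increments_indep:
  assumes W: "wiener_process M W" and \<tau>: "0 \<le> \<tau> 0" "mono \<tau>"
  shows "indep_vars (\<lambda>_. borel) (\<lambda>i \<omega>. W (\<tau> (Suc i)) \<omega> - W (\<tau> i) \<omega>) UNIV"
proof -
  have fin: "indep_vars (\<lambda>_. borel) (\<lambda>i \<omega>. W (\<tau> (Suc i)) \<omega> - W (\<tau> i) \<omega>) {..<n}" for n :: nat
  proof -
    have "mono_on {..n} \<tau>" using \<tau> by (auto simp: mono_def mono_on_def)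
    then show ?thesis using W \<tau>(1) unfolding wiener_process_def by blast
  qed
  show ?thesis
    unfolding indep_vars_def2
  proof (intro conjI ballI)
    show "random_variable borel (\<lambda>\<omega>. W (\<tau> (Suc i)) \<omega> - W (\<tau> i) \<omega>)" for i
      using fin[of "Suc i"] unfolding indep_vars_def2 by auto
    show "indep_sets (\<lambda>i. {(\<lambda>\<omega>. W (\<tau> (Suc i)) \<omega> - W (\<tau> i) \<omega>) -` A \<inter> space M |A. A \<in> sets borel}) UNIV"
    proof (subst indep_sets_finite_index_sets, intro allI impI)
      fix J :: "nat set" assume "finite J"
      then obtain n where "J \<subseteq> {..<n}"
        using finite_nat_bounded by blast
      then show "indep_sets (\<lambda>i. {(\<lambda>\<omega>. W (\<tau> (Suc i)) \<omega> - W (\<tau> i) \<omega>) -` A \<inter> space M |A. A \<in> sets borel}) J"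
        using fin[of n] unfolding indep_vars_def2 by (blast intro: indep_sets_mono_index)
    qed
  qed
qed

lemma (in prob_space) wiener_increment_normal:
  assumes W: "wiener_process M W" and "0 \<le> s" "s < t"
  shows "distributed M lborel (\<lambda>\<omega>. W t \<omega> - W s \<omega>) (normal_density 0 (sqrt (t - s)))"
proof -
  have [measurable]: "W t \<in> borel_measurable M" "W s \<in> borel_measurable M"
    using assms unfolding wiener_process_def by auto
  have "distr M borel (\<lambda>\<omega>. W t \<omega> - W s \<omega>) = gaussian 0 (t - s)"
    using assms unfolding wiener_process_def by auto
  moreover have "distr M borel (\<lambda>\<omega>. W t \<omega> - W s \<omega>) = distr M lborel (\<lambda>\<omega>. W t \<omega> - W s \<omega>)"
    by (intro distr_cong) auto
  ultimately show ?thesis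
    using assms by (auto simp: distributed_def gaussian_def)
qed

text \<open>
  Labels of the independent variables from which the discretised system is built: the initial value of \<open>Y\<close>,
  the increments of \<open>V\<close> over a mesh of width \<open>1 / N\<close>, and those of \<open>W\<close> over unit intervals. The latter are not
  refined because \<open>W\<close> enters the observations only through them.
\<close>

datatype innovation_index = Initial | VInc nat | WInc nat

fun innovation :: "nat \<Rightarrow> (real \<Rightarrow> 'a \<Rightarrow> real) \<Rightarrow> (real \<Rightarrow> 'a \<Rightarrow> real) \<Rightarrow> (real \<Rightarrow> 'a \<Rightarrow> real) \<Rightarrow>
    innovation_index \<Rightarrow> 'a \<Rightarrow> real" where
  "innovation N Y V W Initial \<omega> = Y 0 \<omega>"
| "innovation N Y V W (VInc i) \<omega> = V (real (Suc i) / real N) \<omega> - V (real i / real N) \<omega>"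
| "innovation N Y V W (WInc k) \<omega> = W (real (Suc k)) \<omega> - W (real k) \<omega>"

lemma (in prob_space) Int_stable_sigma_sets:
  assumes "A \<subseteq> Pow (space M)"
  shows "Int_stable (sigma_sets (space M) A)"
proof -
  interpret sigma_algebra "space M" "sigma_sets (space M) A"
    by (rule sigma_algebra_sigma_sets) fact
  show ?thesis by (auto intro: Int_stableI)
qed

lemma (in prob_space) indep_vars_reindex_inv:
  assumes X: "indep_vars (\<lambda>_. N) (\<lambda>i. X (h i)) UNIV" and h: "inj h"
  shows "indep_vars (\<lambda>_. N) X (range h)"
  unfolding indep_vars_def2
proof (intro conjI ballI)
  show "random_variable N (X j)" if "j \<in> range h" for j
    using X that unfolding indep_vars_def2 by auto
  have ind: "indep_sets (\<lambda>i. {X (h i) -` A \<inter> space M |A. A \<in> sets N}) UNIV"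
    using X unfolding indep_vars_def2 by auto
  show "indep_sets (\<lambda>j. {X j -` A \<inter> space M |A. A \<in> sets N}) (range h)"
  proof (rule indep_setsI)
    fix j assume "j \<in> range h"
    then show "{X j -` A \<inter> space M |A. A \<in> sets N} \<subseteq> events"
      using ind unfolding indep_sets_def by auto
  next
    fix A J assume J: "J \<noteq> {}" "J \<subseteq> range h" "finite J" "\<forall>j\<in>J. A j \<in> {X j -` E \<inter> space M |E. E \<in> sets N}"
    define K where "K = h -` J"
    have K: "J = h ` K" "finite K"
      using J h unfolding K_def by (auto intro: finite_vimageI)
    then have "K \<noteq> {}" using J(1) by auto
    have inj: "inj_on h K" using h by (rule inj_on_subset) auto
    have "prob (\<Inter>k\<in>K. A (h k)) = (\<Prod>k\<in>K. prob (A (h k)))"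
      using J(4) K \<open>K \<noteq> {}\<close> by (intro indep_setsD[OF ind]) auto
    then show "prob (\<Inter>j\<in>J. A j) = (\<Prod>j\<in>J. prob (A j))"
      unfolding K by (simp add: prod.reindex[OF inj])
  qed
qed

text \<open>
  Increments of \<open>V\<close> and of \<open>W\<close> are events of the respective path spaces, so independence of the paths makes
  the two families independent of each other, and independence of \<open>(X 0, Y 0)\<close> from the pair of paths adds the
  initial value.
\<close>

lemma innovation_indep:
  assumes sys: "partially_observed_system M f a b \<sigma> d\<^sub>x d\<^sub>y W V X Y" and N: "0 < N"
  shows "prob_space.indep_vars M (\<lambda>_. borel) (innovation N Y V W) UNIV"
proof -
  interpret prob_space M using sys unfolding partially_observed_system_def by auto
  let ?X = "innovation N Y V W"
  let ?P = "path_space {0..}"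
  have wW: "wiener_process M W" and wV: "wiener_process M V"
    and indWV: "indep_var ?P (path_on {0..} W) ?P (path_on {0..} V)"
    and ind0: "indep_set (sets (vimage_algebra (space M) (\<lambda>\<omega>. (X 0 \<omega>, Y 0 \<omega>)) (borel \<Otimes>\<^sub>M borel)))
       (sets (vimage_algebra (space M) (\<lambda>\<omega>. (path_on {0..} W \<omega>, path_on {0..} V \<omega>)) (?P \<Otimes>\<^sub>M ?P)))"
    and Y0[measurable]: "Y 0 \<in> borel_measurable M"
    using sys unfolding partially_observed_system_def by auto
  have [simp]: "path_on {0..} U \<omega> \<in> space ?P" for U :: "real \<Rightarrow> 'a \<Rightarrow> real" and \<omega>
    by (auto simp: space_PiM)
  have incr: "{x \<in> space ?P. x t - x s \<in> E} \<in> sets ?P" if "E \<in> sets borel" "0 \<le> s" "0 \<le> t" for E s t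
  proof -
    have [measurable]: "E \<in> sets borel" by fact
    have [measurable]: "(\<lambda>x. x t) \<in> borel_measurable ?P" "(\<lambda>x. x s) \<in> borel_measurable ?P"
      using that by (auto intro: measurable_component_singleton)
    show ?thesis by measurable
  qed
  have pre: "(\<lambda>\<omega>. U t \<omega> - U s \<omega>) -` E \<inter> space M = path_on {0..} U -` {x \<in> space ?P. x t - x s \<in> E} \<inter> space M"
    if "0 \<le> s" "0 \<le> t" for U :: "real \<Rightarrow> 'a \<Rightarrow> real" and s t E
    using that by (auto simp: space_PiM)
  have basic: "(\<lambda>\<omega>. U t \<omega> - U s \<omega>) -` E \<inter> space M
      \<in> sigma_sets (space M) {path_on {0..} U -` A \<inter> space M |A. A \<in> sets ?P}"
    if "E \<in> sets borel" "0 \<le> s" "0 \<le> t" for U :: "real \<Rightarrow> 'a \<Rightarrow> real" and s t E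
    unfolding pre[OF that(2,3)] using incr[OF that] by (intro sigma_sets.Basic) blast
  define \<W> \<V> where "\<W> = sigma_sets (space M) {path_on {0..} W -` A \<inter> space M |A. A \<in> sets ?P}"
    and "\<V> = sigma_sets (space M) {path_on {0..} V -` A \<inter> space M |A. A \<in> sets ?P}"
  have "indep_vars (\<lambda>_. borel) ?X (range VInc)"
  proof (rule indep_vars_reindex_inv)
    show "indep_vars (\<lambda>_. borel) (\<lambda>i. ?X (VInc i)) UNIV"
      using wiener_increments_indep[OF wV, of "\<lambda>i. real i / real N"] N
      by (simp add: monoI divide_right_mono innovation.simps[abs_def])
  qed (auto simp: inj_def)
  moreover have "indep_vars (\<lambda>_. borel) ?X (range WInc)"
  proof (rule indep_vars_reindex_inv)
    show "indep_vars (\<lambda>_. borel) (\<lambda>i. ?X (WInc i)) UNIV"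
      using wiener_increments_indep[OF wW, of real]
      by (simp add: monoI innovation.simps[abs_def])
  qed (auto simp: inj_def)
  moreover have "indep_set \<W> \<V>"
    using indWV unfolding indep_var_eq \<W>_def \<V>_def by auto
  ultimately have VW: "indep_vars (\<lambda>_. borel) ?X (range WInc \<union> range VInc)"
  proof (intro indep_vars_Un[of _ _ _ _ \<W> \<V>])
    show "Int_stable \<W>" "Int_stable \<V>"
      unfolding \<W>_def \<V>_def by (auto intro!: Int_stable_sigma_sets)
    fix i and E :: "real set" assume E: "E \<in> sets borel"
    show "?X i -` E \<inter> space M \<in> \<W>" if iW: "i \<in> range WInc"
    proof -
      obtain k where i: "i = WInc k" using iW by auto
      show ?thesis
        unfolding i innovation.simps[abs_def] \<W>_def
        by (intro basic E) simp_all
    qed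
    show "?X i -` E \<inter> space M \<in> \<V>" if iV: "i \<in> range VInc"
    proof -
      obtain k where i: "i = VInc k" using iV by auto
      show ?thesis
        unfolding i innovation.simps[abs_def] \<V>_def
        by (intro basic E) simp_all
    qed
  qed
  have I0: "indep_vars (\<lambda>_. borel) ?X {Initial}"
    unfolding indep_vars_def2
  proof (intro conjI ballI)
    show "random_variable borel (?X i)" if "i \<in> {Initial}" for i
      using that by (simp add: innovation.simps[abs_def])
    show "indep_sets (\<lambda>i. {?X i -` A \<inter> space M |A. A \<in> sets borel}) {Initial}"
    proof (rule indep_setsI)
      show "{?X i -` A \<inter> space M |A. A \<in> sets borel} \<subseteq> events" if "i \<in> {Initial}" for i
        using that by (auto simp: innovation.simps[abs_def])
      show "prob (\<Inter>j\<in>J. A j) = (\<Prod>j\<in>J. prob (A j))"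
        if "J \<noteq> {}" "J \<subseteq> {Initial}" for A :: "innovation_index \<Rightarrow> 'a set" and J
        using that by (simp add: subset_singleton_iff)
    qed
  qed
  have "indep_vars (\<lambda>_. borel) ?X ({Initial} \<union> (range WInc \<union> range VInc))"
  proof (rule indep_vars_Un[OF I0 VW ind0])
    show "Int_stable (sets (vimage_algebra (space M) (\<lambda>\<omega>. (X 0 \<omega>, Y 0 \<omega>)) (borel \<Otimes>\<^sub>M borel)))"
      "Int_stable (sets (vimage_algebra (space M) (\<lambda>\<omega>. (path_on {0..} W \<omega>, path_on {0..} V \<omega>)) (?P \<Otimes>\<^sub>M ?P)))"
      by (rule sets.Int_stable)+
    fix i and E :: "real set" assume E: "E \<in> sets borel"
    note [measurable] = E
    show "?X i -` E \<inter> space M \<in> sets (vimage_algebra (space M) (\<lambda>\<omega>. (X 0 \<omega>, Y 0 \<omega>)) (borel \<Otimes>\<^sub>M borel))"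
      if "i \<in> {Initial}"
    proof -
      have "?X i -` E \<inter> space M = (\<lambda>\<omega>. (X 0 \<omega>, Y 0 \<omega>)) -` (UNIV \<times> E) \<inter> space M"
        using that by auto
      also have "\<dots> \<in> sets (vimage_algebra (space M) (\<lambda>\<omega>. (X 0 \<omega>, Y 0 \<omega>)) (borel \<Otimes>\<^sub>M borel))"
        by (intro in_vimage_algebra) simp
      finally show ?thesis .
    qed
    show "?X i -` E \<inter> space M \<in> sets (vimage_algebra (space M) (\<lambda>\<omega>. (path_on {0..} W \<omega>, path_on {0..} V \<omega>)) (?P \<Otimes>\<^sub>M ?P))"
      if "i \<in> range WInc \<union> range VInc"
      using that
    proof
      assume "i \<in> range WInc"
      then obtain k where i: "i = WInc k" by auto
      have "?X i -` E \<inter> space M = (\<lambda>\<omega>. (path_on {0..} W \<omega>, path_on {0..} V \<omega>)) -`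
          ({x \<in> space ?P. x (real (Suc k)) - x (real k) \<in> E} \<times> space ?P) \<inter> space M"
        unfolding i innovation.simps[abs_def] by (subst pre) auto
      also have "\<dots> \<in> sets (vimage_algebra (space M) (\<lambda>\<omega>. (path_on {0..} W \<omega>, path_on {0..} V \<omega>)) (?P \<Otimes>\<^sub>M ?P))"
        by (intro in_vimage_algebra pair_measureI incr E sets.top) auto
      finally show ?thesis .
    next
      assume "i \<in> range VInc"
      then obtain k where i: "i = VInc k" by auto
      have "?X i -` E \<inter> space M = (\<lambda>\<omega>. (path_on {0..} W \<omega>, path_on {0..} V \<omega>)) -`
          (space ?P \<times> {x \<in> space ?P. x (real (Suc k) / real N) - x (real k / real N) \<in> E}) \<inter> space M"
        unfolding i innovation.simps[abs_def] by (subst pre) auto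
      also have "\<dots> \<in> sets (vimage_algebra (space M) (\<lambda>\<omega>. (path_on {0..} W \<omega>, path_on {0..} V \<omega>)) (?P \<Otimes>\<^sub>M ?P))"
        by (intro in_vimage_algebra pair_measureI incr E sets.top) auto
      finally show ?thesis .
    qed
  qed
  also have "{Initial} \<union> (range WInc \<union> range VInc) = UNIV"
  proof -
    have "i \<in> {Initial} \<union> (range WInc \<union> range VInc)" for i
      by (cases i) auto
    then show ?thesis by blast
  qed
  finally show ?thesis .
qed

section \<open>The discretised system\<close>

text \<open>
  The sum approximating the Wiener integral of \<open>h (t - k)\<close> over \<open>[k, k + 1]\<close> with respect to \<open>V\<close>.
\<close>

definition wiener_sum :: "(real \<Rightarrow> real) \<Rightarrow> nat \<Rightarrow> (real \<Rightarrow> 'a \<Rightarrow> real) \<Rightarrow> nat \<Rightarrow> 'a \<Rightarrow> real" where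
  "wiener_sum h N V k \<omega> =
     (\<Sum>i<N. h (real i / real N) * (V (real (Suc (k*N + i)) / real N) \<omega> - V (real (k*N + i) / real N) \<omega>))"

text \<open>
  A Riemann sum for the integral of \<open>h\<close> over \<open>[0, 1]\<close>; for the square of a kernel it is the variance of the
  corresponding \<open>wiener_sum\<close>.
\<close>

definition mesh_mean :: "(real \<Rightarrow> real) \<Rightarrow> nat \<Rightarrow> real" where
  "mesh_mean h N = (\<Sum>i<N. h (real i / real N)) / real N"

text \<open>
  A unit of noise entering \<open>Y\<close> at time \<open>u \<le> 1\<close> still contributes \<open>decay a u\<close> to \<open>Y\<close> at time \<open>1\<close>, and has by then
  contributed \<open>response a u\<close>, the integral of this decay, to the integral of \<open>Y\<close>.
\<close>

definition decay :: "real \<Rightarrow> real \<Rightarrow> real" where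
  "decay a u = exp (- a * (1 - u))"

definition response :: "real \<Rightarrow> real \<Rightarrow> real" where
  "response a u = (1 - exp (- a * (1 - u))) / a"

lemma decay_bounds: "0 < a \<Longrightarrow> u < 1 \<Longrightarrow> 0 < decay a u \<and> decay a u \<le> 1"
  by (simp add: decay_def)

lemma response_bounds:
  assumes "0 < a" "0 \<le> u" "u < 1"
  shows "0 < response a u \<and> response a u \<le> 1"
proof -
  have "1 - exp (- a * (1 - u)) \<le> a * (1 - u)"
    using exp_ge_add_one_self[of "- a * (1 - u)"] by simp
  also have "\<dots> \<le> a" using assms by simp
  finally show ?thesis
    using assms by (simp add: response_def)
qed

lemma mesh_mean_le:
  assumes "0 < N" and "\<And>u. 0 \<le> u \<Longrightarrow> u < 1 \<Longrightarrow> h u \<le> 1"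
  shows "mesh_mean h N \<le> 1"
proof -
  have "(\<Sum>i<N. h (real i / real N)) \<le> (\<Sum>i<N. 1)"
    using assms by (intro sum_mono) auto
  then show ?thesis using assms(1) by (simp add: mesh_mean_def)
qed

lemma mesh_mean_pos:
  assumes "0 < N" and "\<And>u. 0 \<le> u \<Longrightarrow> u < 1 \<Longrightarrow> 0 < h u"
  shows "0 < mesh_mean h N"
  unfolding mesh_mean_def using assms by (intro divide_pos_pos sum_pos) auto

text \<open>
  Positivity of the kernel keeps every summand non-degenerate, so that each of them has a normal density.
\<close>

lemma (in prob_space) wiener_sum_normal:
  assumes V: "wiener_process M V" and N: "0 < N" and h: "\<And>u. 0 \<le> u \<Longrightarrow> u < 1 \<Longrightarrow> 0 < h u"
  shows "distributed M lborel (wiener_sum h N V k) (normal_density 0 (sqrt (mesh_mean (\<lambda>u. (h u)\<^sup>2) N)))"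
proof -
  define Z where "Z i \<omega> = V (real (Suc (k*N + i)) / real N) \<omega> - V (real (k*N + i) / real N) \<omega>" for i \<omega>
  define c where "c i = h (real i / real N)" for i
  have c: "0 < c i" if "i < N" for i using that h by (simp add: c_def)
  have "indep_vars (\<lambda>_. borel) Z UNIV"
    using wiener_increments_indep[OF V, of "\<lambda>i. real (k*N + i) / real N"] N
    unfolding Z_def[abs_def] by (auto simp: monoI divide_right_mono)
  then have "indep_vars (\<lambda>_. borel) (\<lambda>i \<omega>. c i * Z i \<omega>) UNIV"
    by (rule indep_vars_compose2) auto
  then have ind: "indep_vars (\<lambda>_. borel) (\<lambda>i \<omega>. c i * Z i \<omega>) {..<N}"
    by (rule indep_vars_subset) auto
  have nrm: "distributed M lborel (\<lambda>\<omega>. c i * Z i \<omega>) (normal_density 0 (c i * sqrt (1 / N)))" if "i < N" for i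
  proof -
    have "distributed M lborel (Z i) (normal_density 0 (sqrt (real (Suc (k*N + i)) / real N - real (k*N + i) / real N)))"
      unfolding Z_def[abs_def] using N
      by (intro wiener_increment_normal V) (auto simp: divide_strict_right_mono)
    also have "real (Suc (k*N + i)) / real N - real (k*N + i) / real N = 1 / real N"
      by (simp add: diff_divide_distrib[symmetric])
    finally show ?thesis
      using normal_density_affine[of "Z i" 0 "sqrt (1 / N)" "c i" 0] N c[OF that] by simp
  qed
  have "distributed M lborel (\<lambda>\<omega>. \<Sum>i<N. c i * Z i \<omega>)
     (normal_density (\<Sum>i<N. 0) (sqrt (\<Sum>i<N. (c i * sqrt (1 / N))\<^sup>2)))"
    using N c nrm by (intro sum_indep_normal ind) auto
  moreover have "(\<Sum>i<N. (c i * sqrt (1 / N))\<^sup>2) = mesh_mean (\<lambda>u. (h u)\<^sup>2) N"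
    using N by (simp add: mesh_mean_def c_def power_mult_distrib sum_divide_distrib)
  ultimately show ?thesis
    unfolding wiener_sum_def[abs_def] c_def Z_def by simp
qed

lemma (in prob_space) normal_second_moment:
  assumes "0 < s" "distributed M lborel Z (normal_density 0 (sqrt s))"
  shows "expectation (\<lambda>\<omega>. (Z \<omega>)\<^sup>2) = s"
  using normal_even_moment(2)[of "sqrt s" Z 1] assms by simp

text \<open>
  The solution of the linear equation for \<open>Y\<close>, observed at integer times, satisfies this recursion with a Wiener
  integral in place of the sum.
\<close>

fun discrete_state :: "nat \<Rightarrow> real \<Rightarrow> real \<Rightarrow> (real \<Rightarrow> 'a \<Rightarrow> real) \<Rightarrow> (real \<Rightarrow> 'a \<Rightarrow> real) \<Rightarrow> nat \<Rightarrow> 'a \<Rightarrow> real" where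
  "discrete_state N a b Y V 0 \<omega> = Y 0 \<omega>"
| "discrete_state N a b Y V (Suc k) \<omega> =
     exp (- a) * discrete_state N a b Y V k \<omega> + b * wiener_sum (decay a) N V k \<omega>"

text \<open>
  The part of an observed increment that is independent of the past.
\<close>

definition discrete_noise ::
  "nat \<Rightarrow> real \<Rightarrow> real \<Rightarrow> real \<Rightarrow> real \<Rightarrow> (real \<Rightarrow> 'a \<Rightarrow> real) \<Rightarrow> (real \<Rightarrow> 'a \<Rightarrow> real) \<Rightarrow> nat \<Rightarrow> 'a \<Rightarrow> real" where
  "discrete_noise N f a b \<sigma> V W k \<omega> =
     f * b * wiener_sum (response a) N V k \<omega> + \<sigma> * (W (real (Suc k)) \<omega> - W (real k) \<omega>)"

text \<open>
  The integral of \<open>f * exp (- a * s)\<close> over \<open>[0, 1]\<close>: the effect of the value of \<open>Y\<close> at the beginning of a unit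
  interval on the observed increment.
\<close>

definition gain :: "real \<Rightarrow> real \<Rightarrow> real" where
  "gain f a = f * (1 - exp (- a)) / a"

text \<open>
  Chosen so that \<open>(gain f a * y)\<^sup>2 = feedback f a * (y\<^sup>2 - (exp (- a) * y)\<^sup>2)\<close>: it trades the square of the
  signal against the decrease of the square of the state.
\<close>

definition feedback :: "real \<Rightarrow> real \<Rightarrow> real" where
  "feedback f a = (gain f a)\<^sup>2 / (1 - exp (- a) ^ 2)"

text \<open>
  The mean of \<open>\<zeta>\<^sup>2 + feedback f a * \<xi>\<^sup>2\<close> for the noises \<open>\<zeta>\<close> and \<open>\<xi>\<close> of the observation and of the state.
\<close>

definition discrete_Psi :: "nat \<Rightarrow> real \<Rightarrow> real \<Rightarrow> real \<Rightarrow> real \<Rightarrow> real" where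
  "discrete_Psi N f a b \<sigma> = (f * b)\<^sup>2 * mesh_mean (\<lambda>u. (response a u)\<^sup>2) N + \<sigma>\<^sup>2
     + feedback f a * (b\<^sup>2 * mesh_mean (\<lambda>u. (decay a u)\<^sup>2) N)"

text \<open>
  What remains of a squared increment after removal of its mean and of the telescoping term; both brackets are
  centred and independent of the past, and the first is multiplied by a variable of the past.
\<close>

definition martingale_diff ::
  "nat \<Rightarrow> real \<Rightarrow> real \<Rightarrow> real \<Rightarrow> real \<Rightarrow> (real \<Rightarrow> 'a \<Rightarrow> real) \<Rightarrow> (real \<Rightarrow> 'a \<Rightarrow> real) \<Rightarrow> (real \<Rightarrow> 'a \<Rightarrow> real) \<Rightarrow> nat \<Rightarrow> 'a \<Rightarrow> real" where
  "martingale_diff N f a b \<sigma> Y V W k \<omega> =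
     discrete_state N a b Y V k \<omega> *
       (2 * gain f a * discrete_noise N f a b \<sigma> V W k \<omega>
        + 2 * feedback f a * exp (- a) * b * wiener_sum (decay a) N V k \<omega>)
     + ((discrete_noise N f a b \<sigma> V W k \<omega>)\<^sup>2 + feedback f a * (b * wiener_sum (decay a) N V k \<omega>)\<^sup>2
        - discrete_Psi N f a b \<sigma>)"

definition discrete_increment ::
  "nat \<Rightarrow> real \<Rightarrow> real \<Rightarrow> real \<Rightarrow> real \<Rightarrow> (real \<Rightarrow> 'a \<Rightarrow> real) \<Rightarrow> (real \<Rightarrow> 'a \<Rightarrow> real) \<Rightarrow> (real \<Rightarrow> 'a \<Rightarrow> real) \<Rightarrow> nat \<Rightarrow> 'a \<Rightarrow> real" where
  "discrete_increment N f a b \<sigma> Y V W k \<omega> =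
     gain f a * discrete_state N a b Y V k \<omega> + discrete_noise N f a b \<sigma> V W k \<omega>"

text \<open>
  A pathwise identity, by expanding the squares of \<open>gain * y + \<zeta>\<close> and of the next state
  \<open>exp (- a) * y + \<xi>\<close>. Since \<open>discrete_Psi\<close> is the mean of a squared increment in the stationary regime, the
  telescoping term accounts for the distance of the initial value from that regime.
\<close>

lemma martingale_decomposition:
  assumes a: "0 < a"
  shows "(\<Sum>k<T. (discrete_increment N f a b \<sigma> Y V W k \<omega>)\<^sup>2 - discrete_Psi N f a b \<sigma>)
     = feedback f a * ((discrete_state N a b Y V 0 \<omega>)\<^sup>2 - (discrete_state N a b Y V T \<omega>)\<^sup>2)
       + (\<Sum>k<T. martingale_diff N f a b \<sigma> Y V W k \<omega>)"
proof (induction T)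
  case 0
  show ?case by simp
next
  case (Suc T)
  define q where "q = exp (- a)"
  define y where "y = discrete_state N a b Y V T \<omega>"
  define \<xi> where "\<xi> = b * wiener_sum (decay a) N V T \<omega>"
  define \<zeta> where "\<zeta> = discrete_noise N f a b \<sigma> V W T \<omega>"
  have "q ^ 2 < 1"
    using a by (simp add: q_def abs_square_less_1)
  then have g: "(gain f a)\<^sup>2 = feedback f a * (1 - q\<^sup>2)"
    by (simp add: feedback_def q_def)
  have y': "discrete_state N a b Y V (Suc T) \<omega> = q * y + \<xi>"
    by (simp add: q_def y_def \<xi>_def)
  have "(gain f a * y + \<zeta>)\<^sup>2 = (gain f a)\<^sup>2 * y\<^sup>2 + 2 * gain f a * y * \<zeta> + \<zeta>\<^sup>2"
    by (simp add: power2_eq_square algebra_simps)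
  also have "\<dots> = feedback f a * (y\<^sup>2 - (q * y + \<xi>)\<^sup>2)
      + (y * (2 * gain f a * \<zeta> + 2 * feedback f a * q * \<xi>) + (\<zeta>\<^sup>2 + feedback f a * \<xi>\<^sup>2))"
    unfolding g by (simp add: power2_eq_square algebra_simps)
  finally have step: "(discrete_increment N f a b \<sigma> Y V W T \<omega>)\<^sup>2 - discrete_Psi N f a b \<sigma>
     = feedback f a * (y\<^sup>2 - (discrete_state N a b Y V (Suc T) \<omega>)\<^sup>2) + martingale_diff N f a b \<sigma> Y V W T \<omega>"
    unfolding y' by (simp add: discrete_increment_def martingale_diff_def y_def \<zeta>_def \<xi>_def q_def algebra_simps)
  show ?case
    unfolding sum.lessThan_Suc Suc step by (simp add: y_def algebra_simps)
qed

text \<open>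
  The innovations that have occurred up to time \<open>k\<close>, and those of the interval from \<open>k\<close> to \<open>k + 1\<close>.
\<close>

definition past :: "nat \<Rightarrow> nat \<Rightarrow> innovation_index set" where
  "past N k = insert Initial (VInc ` {..<k*N} \<union> WInc ` {..<k})"

definition block :: "nat \<Rightarrow> nat \<Rightarrow> innovation_index set" where
  "block N k = insert (WInc k) (VInc ` {k*N..<Suc k*N})"

lemma past_disjoint_block: "past N k \<inter> block N k = {}"
  by (auto simp: past_def block_def)

lemma past_Suc: "past N (Suc k) = past N k \<union> block N k"
proof -
  have "{..<Suc k*N} = {..<k*N} \<union> {k*N..<Suc k*N}"
    by auto
  moreover have "{..<Suc k} = insert k {..<k}" by auto
  ultimately show ?thesis
    unfolding past_def block_def by (simp only: image_Un image_insert) blast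
qed

abbreviation history ::
  "'a measure \<Rightarrow> nat \<Rightarrow> (real \<Rightarrow> 'a \<Rightarrow> real) \<Rightarrow> (real \<Rightarrow> 'a \<Rightarrow> real) \<Rightarrow> (real \<Rightarrow> 'a \<Rightarrow> real) \<Rightarrow> innovation_index set \<Rightarrow> 'a measure" where
  "history M N Y V W A \<equiv> generated_sigma M (innovation N Y V W) A"

lemma wiener_sum_history:
  assumes "VInc ` {k*N..<Suc k*N} \<subseteq> A"
  shows "wiener_sum h N V k \<in> borel_measurable (history M N Y V W A)"
proof -
  have inc: "innovation N Y V W (VInc (k*N + i)) \<in> borel_measurable (history M N Y V W A)" if "i < N" for i
    using that assms by (intro measurable_generated_sigma) auto
  have "(\<lambda>\<omega>. \<Sum>i<N. h (real i / real N) * innovation N Y V W (VInc (k*N + i)) \<omega>) \<in> borel_measurable (history M N Y V W A)"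
    by (intro borel_measurable_sum borel_measurable_times borel_measurable_const inc) simp
  then show ?thesis
    by (simp add: wiener_sum_def[abs_def])
qed

lemma W_increment_history:
  assumes "WInc k \<in> A"
  shows "(\<lambda>\<omega>. W (real (Suc k)) \<omega> - W (real k) \<omega>) \<in> borel_measurable (history M N Y V W A)"
  using measurable_generated_sigma[OF assms, of "innovation N Y V W" M] by (simp add: innovation.simps[abs_def])

lemma discrete_noise_history:
  "discrete_noise N f a b \<sigma> V W k \<in> borel_measurable (history M N Y V W (block N k))"
  unfolding discrete_noise_def[abs_def]
  by (intro borel_measurable_add borel_measurable_times borel_measurable_const
      wiener_sum_history W_increment_history) (auto simp: block_def)

lemma discrete_state_history:
  "discrete_state N a b Y V k \<in> borel_measurable (history M N Y V W (past N k))"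
proof (induction k)
  case 0
  have "innovation N Y V W Initial \<in> borel_measurable (history M N Y V W (past N 0))"
    by (intro measurable_generated_sigma) (simp add: past_def)
  then show ?case by (simp add: innovation.simps[abs_def] discrete_state.simps[abs_def])
next
  case (Suc k)
  have "discrete_state N a b Y V k \<in> borel_measurable (history M N Y V W (past N (Suc k)))"
    by (rule generated_sigma_mono[OF Suc]) (simp add: past_Suc)
  moreover have "wiener_sum (decay a) N V k \<in> borel_measurable (history M N Y V W (past N (Suc k)))"
    by (rule wiener_sum_history) (auto simp: past_Suc block_def)
  ultimately show ?case
    unfolding discrete_state.simps[abs_def] by measurable
qed

lemma martingale_diff_history:
  "martingale_diff N f a b \<sigma> Y V W k \<in> borel_measurable (history M N Y V W (past N (Suc k)))"
proof -
  have [measurable]: "discrete_state N a b Y V k \<in> borel_measurable (history M N Y V W (past N (Suc k)))"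
    by (rule generated_sigma_mono[OF discrete_state_history]) (simp add: past_Suc)
  have [measurable]: "discrete_noise N f a b \<sigma> V W k \<in> borel_measurable (history M N Y V W (past N (Suc k)))"
    by (rule generated_sigma_mono[OF discrete_noise_history]) (simp add: past_Suc)
  have [measurable]: "wiener_sum (decay a) N V k \<in> borel_measurable (history M N Y V W (past N (Suc k)))"
    by (rule wiener_sum_history) (auto simp: past_Suc block_def)
  show ?thesis
    unfolding martingale_diff_def[abs_def] by measurable
qed

lemma martingale_sum_history:
  "(\<lambda>\<omega>. \<Sum>k<n. martingale_diff N f a b \<sigma> Y V W k \<omega>) \<in> borel_measurable (history M N Y V W (past N n))"
proof (induction n)
  case (Suc n)
  have "(\<lambda>\<omega>. \<Sum>k<n. martingale_diff N f a b \<sigma> Y V W k \<omega>) \<in> borel_measurable (history M N Y V W (past N (Suc n)))"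
    by (rule generated_sigma_mono[OF Suc]) (simp add: past_Suc)
  then show ?case
    using martingale_diff_history[of N f a b \<sigma> Y V W n M] by simp
qed simp

text \<open>
  The two innovation brackets of \<open>martingale_diff\<close> have mean zero, the second by the choice of
  \<open>discrete_Psi\<close> and because the increment of \<open>W\<close> is uncorrelated with those of \<open>V\<close>. Both depend on the block
  of time \<open>k\<close> only and are thus independent of \<open>G\<close> and of the state.
\<close>

lemma martingale_diff_orthogonal:
  assumes sys: "partially_observed_system M f a b \<sigma> d\<^sub>x d\<^sub>y W V X Y" and N: "0 < N" and a: "0 < a"
    and G: "G \<in> borel_measurable (history M N Y V W (past N k))"
    and int_G: "integrable M G" and int_GY: "integrable M (\<lambda>\<omega>. G \<omega> * discrete_state N a b Y V k \<omega>)"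
  shows "(\<integral>\<omega>. G \<omega> * martingale_diff N f a b \<sigma> Y V W k \<omega> \<partial>M) = 0"
proof -
  interpret prob_space M using sys unfolding partially_observed_system_def by auto
  have wW: "wiener_process M W" and wV: "wiener_process M V"
    using sys unfolding partially_observed_system_def by auto
  note ind = indep_var_generated_sigma[OF innovation_indep[OF sys N]]
  define J where "J = wiener_sum (response a) N V k"
  define H where "H = wiener_sum (decay a) N V k"
  define U where "U \<omega> = W (real (Suc k)) \<omega> - W (real k) \<omega>" for \<omega>
  define sJ sH where "sJ = mesh_mean (\<lambda>u. (response a u)\<^sup>2) N" and "sH = mesh_mean (\<lambda>u. (decay a u)\<^sup>2) N"
  have sJ0: "0 < sJ" unfolding sJ_def
    using response_bounds[OF a] by (intro mesh_mean_pos N zero_less_power) auto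
  have sH0: "0 < sH" unfolding sH_def
    using decay_bounds[OF a] by (intro mesh_mean_pos N zero_less_power) auto
  have J: "distributed M lborel J (normal_density 0 (sqrt sJ))"
    unfolding J_def sJ_def using response_bounds[OF a] by (intro wiener_sum_normal wV N) auto
  have H: "distributed M lborel H (normal_density 0 (sqrt sH))"
    unfolding H_def sH_def using decay_bounds[OF a] by (intro wiener_sum_normal wV N) auto
  have U: "distributed M lborel U (normal_density 0 (sqrt 1))"
    unfolding U_def[abs_def] using wiener_increment_normal[OF wW, of "real k" "real (Suc k)"] by simp
  have mb: "moments_bounded {()} (\<lambda>_. M) (\<lambda>_. Z)"
    if "0 < s" "distributed M lborel Z (normal_density 0 (sqrt s))" for Z s
    using that by (intro moments_bounded_normal[where s = "\<lambda>_. sqrt s" and R = "sqrt s"] prob_space_axioms) auto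
  note mbs = mb[OF sJ0 J] mb[OF sH0 H] mb[OF zero_less_one U]
  have int2: "integrable M (\<lambda>\<omega>. Z \<omega> * Z' \<omega>)"
    if "moments_bounded {()} (\<lambda>_. M) (\<lambda>_. Z)" "moments_bounded {()} (\<lambda>_. M) (\<lambda>_. Z')" for Z Z'
    using moments_bounded_integrable[OF moments_bounded_mult[OF that]] prob_space_axioms by simp
  have ints: "integrable M J" "integrable M H" "integrable M U"
    using mbs[THEN moments_bounded_integrable] prob_space_axioms by auto
  have ints2: "integrable M (\<lambda>\<omega>. (J \<omega>)\<^sup>2)" "integrable M (\<lambda>\<omega>. (H \<omega>)\<^sup>2)" "integrable M (\<lambda>\<omega>. (U \<omega>)\<^sup>2)"
     "integrable M (\<lambda>\<omega>. J \<omega> * U \<omega>)"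
    unfolding power2_eq_square by (intro int2 mbs)+
  have EJ: "expectation J = 0" and EH: "expectation H = 0" and EU: "expectation U = 0"
    using normal_distributed_expectation[OF _ J] normal_distributed_expectation[OF _ H]
      normal_distributed_expectation[OF _ U] sJ0 sH0 by auto
  have EJ2: "expectation (\<lambda>\<omega>. (J \<omega>)\<^sup>2) = sJ" and EH2: "expectation (\<lambda>\<omega>. (H \<omega>)\<^sup>2) = sH"
    and EU2: "expectation (\<lambda>\<omega>. (U \<omega>)\<^sup>2) = 1"
    using normal_second_moment[OF sJ0 J] normal_second_moment[OF sH0 H] normal_second_moment[OF _ U] by auto
  have JU: "indep_var borel J borel U"
    unfolding J_def U_def[abs_def]
    by (rule ind[of "range VInc" "{WInc k}"], blast, rule wiener_sum_history, blast, rule W_increment_history, simp)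
  have EJU: "expectation (\<lambda>\<omega>. J \<omega> * U \<omega>) = 0"
    using indep_var_lebesgue_integral[OF JU ints(1,3)] EU by simp
  define u where "u \<omega> = 2 * gain f a * discrete_noise N f a b \<sigma> V W k \<omega>
        + 2 * feedback f a * exp (- a) * b * H \<omega>" for \<omega>
  define w where "w \<omega> = (discrete_noise N f a b \<sigma> V W k \<omega>)\<^sup>2 + feedback f a * (b * H \<omega>)\<^sup>2
        - discrete_Psi N f a b \<sigma>" for \<omega>
  have noise: "discrete_noise N f a b \<sigma> V W k \<omega> = f * b * J \<omega> + \<sigma> * U \<omega>" for \<omega>
    by (simp add: discrete_noise_def J_def U_def)
  have u: "u = (\<lambda>\<omega>. 2 * gain f a * (f * b) * J \<omega> + 2 * gain f a * \<sigma> * U \<omega> + 2 * feedback f a * exp (- a) * b * H \<omega>)"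
    unfolding u_def[abs_def] noise by (simp add: algebra_simps)
  have w: "w = (\<lambda>\<omega>. (f * b)\<^sup>2 * (J \<omega>)\<^sup>2 + 2 * (f * b) * \<sigma> * (J \<omega> * U \<omega>) + \<sigma>\<^sup>2 * (U \<omega>)\<^sup>2
     + feedback f a * b\<^sup>2 * (H \<omega>)\<^sup>2 - discrete_Psi N f a b \<sigma>)"
    unfolding w_def[abs_def] noise by (simp add: algebra_simps power2_eq_square)
  have int_u: "integrable M u" unfolding u using ints by simp
  have int_w: "integrable M w" unfolding w using ints2 by simp
  have Eu: "expectation u = 0" unfolding u using ints by (simp add: EJ EU EH)
  have Ew: "expectation w = 0" unfolding w using ints2
    by (simp add: EJ2 EU2 EH2 EJU discrete_Psi_def prob_space sJ_def[symmetric] sH_def[symmetric])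
  have [measurable]: "H \<in> borel_measurable (history M N Y V W (block N k))"
    unfolding H_def by (rule wiener_sum_history) (auto simp: block_def)
  note [measurable] = discrete_noise_history[of N f a b \<sigma> V W k M Y]
  have mu: "u \<in> borel_measurable (history M N Y V W (block N k))"
    unfolding u_def[abs_def] by measurable
  have mw: "w \<in> borel_measurable (history M N Y V W (block N k))"
    unfolding w_def[abs_def] by measurable
  have mGY: "(\<lambda>\<omega>. G \<omega> * discrete_state N a b Y V k \<omega>) \<in> borel_measurable (history M N Y V W (past N k))"
    by (intro borel_measurable_times G discrete_state_history)
  have iu: "indep_var borel (\<lambda>\<omega>. G \<omega> * discrete_state N a b Y V k \<omega>) borel u"
    by (rule ind[OF past_disjoint_block mGY mu])
  have iw: "indep_var borel G borel w"
    by (rule ind[OF past_disjoint_block G mw])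
  have "(\<lambda>\<omega>. G \<omega> * martingale_diff N f a b \<sigma> Y V W k \<omega>)
     = (\<lambda>\<omega>. (G \<omega> * discrete_state N a b Y V k \<omega>) * u \<omega> + G \<omega> * w \<omega>)"
    by (simp add: martingale_diff_def u_def w_def H_def algebra_simps)
  then show ?thesis
    using indep_var_integrable[OF iu int_GY int_u] indep_var_integrable[OF iw int_G int_w]
      indep_var_lebesgue_integral[OF iu int_GY int_u] indep_var_lebesgue_integral[OF iw int_G int_w]
    by (simp add: Eu Ew)
qed

section \<open>Moment bounds uniform in the parameter and the mesh\<close>

lemma gain_bound:
  assumes "0 < a"
  shows "\<bar>gain f a\<bar> \<le> \<bar>f\<bar>"
proof -
  have "1 - exp (- a) \<le> a"
    using exp_ge_add_one_self[of "- a"] by simp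
  then have "\<bar>f\<bar> * (1 - exp (- a)) / a \<le> \<bar>f\<bar> * a / a"
    using assms by (intro divide_right_mono mult_left_mono) auto
  then show ?thesis
    using assms by (simp add: gain_def abs_mult)
qed

text \<open>
  The denominator stays away from \<open>0\<close> because \<open>a\<close> does.
\<close>

lemma feedback_bound:
  assumes "0 < a\<^sub>0" "a\<^sub>0 \<le> a" "\<bar>f\<bar> \<le> F"
  shows "\<bar>feedback f a\<bar> \<le> F\<^sup>2 / (1 - exp (- a\<^sub>0) ^ 2)"
proof -
  have q0: "exp (- a\<^sub>0) ^ 2 < 1"
    using assms by (simp add: abs_square_less_1)
  have q: "exp (- a) ^ 2 \<le> exp (- a\<^sub>0) ^ 2"
    using assms by (intro power_mono) auto
  have "\<bar>gain f a\<bar> \<le> F"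
    using gain_bound[of a f] assms by simp
  then have "(gain f a)\<^sup>2 \<le> F\<^sup>2"
    by (metis abs_ge_zero power2_abs power_mono)
  then have "(gain f a)\<^sup>2 / (1 - exp (- a) ^ 2) \<le> F\<^sup>2 / (1 - exp (- a\<^sub>0) ^ 2)"
    using q q0 by (intro frac_le) auto
  moreover have "0 < 1 - exp (- a) ^ 2"
    using q q0 by linarith
  then have "0 \<le> feedback f a"
    unfolding feedback_def by (intro divide_nonneg_nonneg) simp_all
  ultimately show ?thesis
    by (simp only: feedback_def abs_of_nonneg)
qed

text \<open>
  The law of \<open>Y 0\<close> is the same for all indices. For \<open>d\<^sub>y = 0\<close> it is a point mass, which has no density and is
  treated separately.
\<close>

lemma moments_bounded_initial:
  assumes sys: "\<And>i. i \<in> I \<Longrightarrow>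
      partially_observed_system (M i) (f i) (a i) (b i) \<sigma> d\<^sub>x d\<^sub>y (W i) (V i) (X i) (Y i)"
  shows "moments_bounded I M (\<lambda>i. Y i 0)"
proof (cases "d\<^sub>y = 0")
  case False
  show ?thesis
  proof (rule moments_bounded_normal[where s = "\<lambda>_. \<bar>d\<^sub>y\<bar>" and R = "\<bar>d\<^sub>y\<bar>"])
    fix i assume i: "i \<in> I"
    show "prob_space (M i)"
      using sys[OF i] unfolding partially_observed_system_def by auto
    have [measurable]: "Y i 0 \<in> borel_measurable (M i)" and "distr (M i) borel (Y i 0) = gaussian 0 (d\<^sub>y\<^sup>2)"
      using sys[OF i] unfolding partially_observed_system_def by auto
    moreover have "distr (M i) borel (Y i 0) = distr (M i) lborel (Y i 0)"
      by (intro distr_cong) auto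
    ultimately show "distributed (M i) lborel (Y i 0) (normal_density 0 \<bar>d\<^sub>y\<bar>)"
      using False by (auto simp: distributed_def gaussian_def)
  qed (use False in auto)
next
  case True
  show ?thesis
  proof (rule moments_boundedI)
    fix i m assume i: "i \<in> I"
    interpret prob_space "M i"
      using sys[OF i] unfolding partially_observed_system_def by auto
    show meas[measurable]: "Y i 0 \<in> borel_measurable (M i)"
      using sys[OF i] unfolding partially_observed_system_def by auto
    have D: "distr (M i) borel (Y i 0) = return borel 0"
      using sys[OF i] True unfolding partially_observed_system_def gaussian_def by auto
    have "AE y in distr (M i) borel (Y i 0). y = 0"
      unfolding D by (subst AE_return) auto
    then have AE0: "AE \<omega> in M i. Y i 0 \<omega> ^ (2*m) = 0 ^ (2*m)"
      by (subst (asm) AE_distr_iff) auto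
    have "integrable (M i) (\<lambda>\<omega>. Y i 0 \<omega> ^ (2*m)) \<longleftrightarrow> integrable (M i) (\<lambda>\<omega>. 0 ^ (2*m) :: real)"
      by (rule integrable_cong_AE) (use AE0 in auto)
    then show "integrable (M i) (\<lambda>\<omega>. Y i 0 \<omega> ^ (2*m))" by simp
    have "(\<integral>\<omega>. Y i 0 \<omega> ^ (2*m) \<partial>M i) = (\<integral>\<omega>. 0 ^ (2*m) \<partial>M i)"
      by (rule integral_cong_AE) (use AE0 in auto)
    then show "(\<integral>\<omega>. Y i 0 \<omega> ^ (2*m) \<partial>M i) \<le> 0 ^ (2*m)"
      by (simp add: prob_space)
  qed
qed

lemma moments_bounded_wiener_sum:
  assumes prob: "\<And>i. i \<in> I \<Longrightarrow> prob_space (M i)" and V: "\<And>i. i \<in> I \<Longrightarrow> wiener_process (M i) (V i)"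
    and N: "\<And>i. i \<in> I \<Longrightarrow> 0 < N i"
    and h: "\<And>i u. i \<in> I \<Longrightarrow> 0 \<le> u \<Longrightarrow> u < 1 \<Longrightarrow> 0 < h i u \<and> h i u \<le> 1"
  shows "moments_bounded I M (\<lambda>i. wiener_sum (h i) (N i) (V i) (k i))"
proof (rule moments_bounded_normal[where s = "\<lambda>i. sqrt (mesh_mean (\<lambda>u. (h i u)\<^sup>2) (N i))" and R = 1])
  fix i assume i: "i \<in> I"
  then show "prob_space (M i)" by (rule prob)
  interpret prob_space "M i" using prob[OF i] .
  show "distributed (M i) lborel (wiener_sum (h i) (N i) (V i) (k i))
      (normal_density 0 (sqrt (mesh_mean (\<lambda>u. (h i u)\<^sup>2) (N i))))"
    using h[OF i] by (intro wiener_sum_normal V[OF i] N[OF i]) auto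
  show "0 < sqrt (mesh_mean (\<lambda>u. (h i u)\<^sup>2) (N i))"
    using h[OF i] by (intro real_sqrt_gt_zero mesh_mean_pos N[OF i] zero_less_power) auto
  show "sqrt (mesh_mean (\<lambda>u. (h i u)\<^sup>2) (N i)) \<le> 1"
    using h[OF i] by (intro real_sqrt_le_1_iff[THEN iffD2] mesh_mean_le N[OF i] power_le_one) (auto intro: less_imp_le)
qed

text \<open>
  The telescoping part contributes boundedly, by uniform moment bounds of the state, and the martingale part is
  of order \<open>T ^ m\<close>. All families are indexed by triples of parameter, mesh and time, so that the constants
  obtained depend on none of them.
\<close>

lemma discrete_quadratic_moment_bound:
  fixes M :: "'i \<Rightarrow> 'a measure"
  assumes sys: "\<And>i. i \<in> I \<Longrightarrow>
      partially_observed_system (M i) (f i) (a i) (b i) \<sigma> d\<^sub>x d\<^sub>y (W i) (V i) (X i) (Y i)"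
    and f: "\<And>i. i \<in> I \<Longrightarrow> \<bar>f i\<bar> \<le> F" and b: "\<And>i. i \<in> I \<Longrightarrow> \<bar>b i\<bar> \<le> B"
    and a: "\<And>i. i \<in> I \<Longrightarrow> a\<^sub>0 \<le> a i" and a0: "0 < a\<^sub>0" and m: "1 \<le> m"
  obtains C where "0 \<le> C" and "\<And>i N T. i \<in> I \<Longrightarrow> 0 < N \<Longrightarrow> 1 \<le> T \<Longrightarrow>
     integrable (M i) (\<lambda>\<omega>. (\<Sum>k<T. (discrete_increment N (f i) (a i) (b i) \<sigma> (Y i) (V i) (W i) k \<omega>)\<^sup>2
         - discrete_Psi N (f i) (a i) (b i) \<sigma>) ^ (2*m)) \<and>
     (\<integral>\<omega>. (\<Sum>k<T. (discrete_increment N (f i) (a i) (b i) \<sigma> (Y i) (V i) (W i) k \<omega>)\<^sup>2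
         - discrete_Psi N (f i) (a i) (b i) \<sigma>) ^ (2*m) \<partial>M i) \<le> C * real T ^ m"
proof -
  define P where "P = I \<times> {0::nat<..}"
  define Ix where "Ix = P \<times> (UNIV :: nat set)"
  have prob: "prob_space (M i)" and wW: "wiener_process (M i) (W i)" and wV: "wiener_process (M i) (V i)"
    if "i \<in> I" for i
    using sys[OF that] unfolding partially_observed_system_def by auto
  have apos: "0 < a i" if "i \<in> I" for i using a[OF that] a0 by linarith
  have mem: "fst (fst x) \<in> I" "0 < snd (fst x)" if "x \<in> Ix" for x
    using that by (auto simp: Ix_def P_def)
  let ?M = "\<lambda>x :: ('i \<times> nat) \<times> nat. M (fst (fst x))"
  define \<phi> where "\<phi> x = f (fst (fst x))" for x :: "('i \<times> nat) \<times> nat"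
  define \<alpha> where "\<alpha> x = a (fst (fst x))" for x :: "('i \<times> nat) \<times> nat"
  define \<beta> where "\<beta> x = b (fst (fst x))" for x :: "('i \<times> nat) \<times> nat"
  define st where "st p k = discrete_state (snd p) (a (fst p)) (b (fst p)) (Y (fst p)) (V (fst p)) k" for p :: "'i \<times> nat" and k
  define J where "J x = wiener_sum (response (\<alpha> x)) (snd (fst x)) (V (fst (fst x))) (snd x)" for x
  define H where "H x = wiener_sum (decay (\<alpha> x)) (snd (fst x)) (V (fst (fst x))) (snd x)" for x
  define U where "U x \<omega> = W (fst (fst x)) (real (Suc (snd x))) \<omega> - W (fst (fst x)) (real (snd x)) \<omega>"
    for x :: "('i \<times> nat) \<times> nat" and \<omega>
  have pM: "prob_space (?M x)" if "x \<in> Ix" for x using prob mem[OF that] by auto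
  have mJ: "moments_bounded Ix ?M J"
    unfolding J_def[abs_def] using mem prob wV response_bounds apos
    by (intro moments_bounded_wiener_sum) (auto simp: \<alpha>_def)
  have mH: "moments_bounded Ix ?M H"
    unfolding H_def[abs_def] using mem prob wV decay_bounds apos
    by (intro moments_bounded_wiener_sum) (auto simp: \<alpha>_def)
  have mU: "moments_bounded Ix ?M U"
  proof (rule moments_bounded_normal[where s = "\<lambda>_. 1" and R = 1])
    fix x assume x: "x \<in> Ix"
    show "prob_space (?M x)" by (rule pM[OF x])
    then show "distributed (?M x) lborel (U x) (normal_density 0 1)"
      using prob_space.wiener_increment_normal[OF _ wW[OF mem(1)[OF x]], of "real (snd x)" "real (Suc (snd x))"]
      by (simp add: U_def[abs_def])
  qed auto
  note const = moments_bounded_const[OF pM]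
  have m\<sigma>: "moments_bounded Ix ?M (\<lambda>x \<omega>. r)" for r
    by (rule const[where R = "\<bar>r\<bar>"]) auto
  have m\<phi>: "moments_bounded Ix ?M (\<lambda>x \<omega>. \<phi> x)"
    by (rule const[where R = F]) (use f mem in \<open>auto simp: \<phi>_def\<close>)
  have m\<beta>: "moments_bounded Ix ?M (\<lambda>x \<omega>. \<beta> x)"
    by (rule const[where R = B]) (use b mem in \<open>auto simp: \<beta>_def\<close>)
  have mq: "moments_bounded Ix ?M (\<lambda>x \<omega>. exp (- \<alpha> x))"
    by (rule const[where R = 1]) (use apos mem in \<open>auto simp: \<alpha>_def intro: less_imp_le\<close>)
  have mgain: "moments_bounded Ix ?M (\<lambda>x \<omega>. gain (\<phi> x) (\<alpha> x))"
  proof (rule const[where R = F])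
    fix x assume "x \<in> Ix"
    then show "\<bar>gain (\<phi> x) (\<alpha> x)\<bar> \<le> F"
      using gain_bound[of "\<alpha> x" "\<phi> x"] f[of "fst (fst x)"] apos[of "fst (fst x)"] mem[of x] by (simp add: \<phi>_def \<alpha>_def)
  qed auto
  have mfb: "moments_bounded Ix ?M (\<lambda>x \<omega>. feedback (\<phi> x) (\<alpha> x))"
  proof (rule const[where R = "F\<^sup>2 / (1 - exp (- a\<^sub>0) ^ 2)"])
    fix x assume "x \<in> Ix"
    then show "\<bar>feedback (\<phi> x) (\<alpha> x)\<bar> \<le> F\<^sup>2 / (1 - exp (- a\<^sub>0) ^ 2)"
      using f a mem[of x] by (intro feedback_bound a0) (auto simp: \<phi>_def \<alpha>_def)
  qed auto
  have mmJ: "moments_bounded Ix ?M (\<lambda>x \<omega>. mesh_mean (\<lambda>u. (response (\<alpha> x) u)\<^sup>2) (snd (fst x)))"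
  proof (rule const[where R = 1])
    fix x assume "x \<in> Ix"
    then have "0 < \<alpha> x" "0 < snd (fst x)" using mem[of x] apos by (auto simp: \<alpha>_def)
    then have "mesh_mean (\<lambda>u. (response (\<alpha> x) u)\<^sup>2) (snd (fst x)) \<le> 1" "0 < mesh_mean (\<lambda>u. (response (\<alpha> x) u)\<^sup>2) (snd (fst x))"
      using response_bounds[of "\<alpha> x"]
      by (auto intro!: mesh_mean_le mesh_mean_pos power_le_one zero_less_power intro: less_imp_le)
    then show "\<bar>mesh_mean (\<lambda>u. (response (\<alpha> x) u)\<^sup>2) (snd (fst x))\<bar> \<le> 1" by simp
  qed auto
  have mmH: "moments_bounded Ix ?M (\<lambda>x \<omega>. mesh_mean (\<lambda>u. (decay (\<alpha> x) u)\<^sup>2) (snd (fst x)))"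
  proof (rule const[where R = 1])
    fix x assume "x \<in> Ix"
    then have "0 < \<alpha> x" "0 < snd (fst x)" using mem[of x] apos by (auto simp: \<alpha>_def)
    then have "mesh_mean (\<lambda>u. (decay (\<alpha> x) u)\<^sup>2) (snd (fst x)) \<le> 1" "0 < mesh_mean (\<lambda>u. (decay (\<alpha> x) u)\<^sup>2) (snd (fst x))"
      using decay_bounds[of "\<alpha> x"]
      by (auto intro!: mesh_mean_le mesh_mean_pos power_le_one zero_less_power intro: less_imp_le)
    then show "\<bar>mesh_mean (\<lambda>u. (decay (\<alpha> x) u)\<^sup>2) (snd (fst x))\<bar> \<le> 1" by simp
  qed auto
  have mst: "moments_bounded Ix ?M (\<lambda>x. st (fst x) (snd x))"
    unfolding Ix_def
  proof (rule moments_bounded_autoregression[where q = "\<lambda>p. exp (- a (fst p))" and q\<^sub>0 = "exp (- a\<^sub>0)"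
        and \<xi> = "\<lambda>p k \<omega>. \<beta> (p, k) * H (p, k) \<omega>"])
    show "prob_space (M (fst p))" if "p \<in> P" for p using that prob by (auto simp: P_def)
    have "(\<lambda>p :: 'i \<times> nat. st p 0) = (\<lambda>p. Y (fst p) 0)"
      by (intro ext) (simp add: st_def)
    then show "moments_bounded P (\<lambda>p. M (fst p)) (\<lambda>p. st p 0)"
      using moments_bounded_reindex[OF moments_bounded_initial[OF sys], of P fst] by (auto simp: P_def)
    show "moments_bounded (P \<times> UNIV) (\<lambda>x. M (fst (fst x))) (\<lambda>x \<omega>. \<beta> (fst x, snd x) * H (fst x, snd x) \<omega>)"
      using moments_bounded_mult[OF m\<beta> mH] by (simp add: Ix_def)
    show "st p (Suc k) \<omega> = exp (- a (fst p)) * st p k \<omega> + \<beta> (p, k) * H (p, k) \<omega>" for p k \<omega>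
      by (simp add: st_def \<beta>_def H_def \<alpha>_def)
    show "exp (- a (fst p)) \<le> exp (- a\<^sub>0)" if "p \<in> P" for p using that a by (auto simp: P_def)
    show "exp (- a\<^sub>0) < 1" using a0 by simp
  qed auto
  define D where "D x = martingale_diff (snd (fst x)) (\<phi> x) (\<alpha> x) (\<beta> x) \<sigma> (Y (fst (fst x))) (V (fst (fst x))) (W (fst (fst x))) (snd x)"
    for x :: "('i \<times> nat) \<times> nat"
  define \<zeta> where "\<zeta> x \<omega> = \<phi> x * \<beta> x * J x \<omega> + \<sigma> * U x \<omega>" for x \<omega>
  have m\<zeta>: "moments_bounded Ix ?M \<zeta>"
    unfolding \<zeta>_def[abs_def] by (intro moments_bounded_add moments_bounded_mult m\<phi> m\<beta> mJ mU m\<sigma>)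
  \<comment> \<open>The definition spelled out with sums and products only, in the form to which the closure rules apply.\<close>
  have D_eq: "D = (\<lambda>x \<omega>. st (fst x) (snd x) \<omega> * (2 * gain (\<phi> x) (\<alpha> x) * \<zeta> x \<omega> + 2 * feedback (\<phi> x) (\<alpha> x) * exp (- \<alpha> x) * \<beta> x * H x \<omega>)
     + (\<zeta> x \<omega> * \<zeta> x \<omega> + feedback (\<phi> x) (\<alpha> x) * ((\<beta> x * H x \<omega>) * (\<beta> x * H x \<omega>))
        + (- 1) * ((\<phi> x * \<beta> x) * (\<phi> x * \<beta> x) * mesh_mean (\<lambda>u. (response (\<alpha> x) u)\<^sup>2) (snd (fst x)) + \<sigma>\<^sup>2
           + feedback (\<phi> x) (\<alpha> x) * (\<beta> x * \<beta> x * mesh_mean (\<lambda>u. (decay (\<alpha> x) u)\<^sup>2) (snd (fst x))))))"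
    by (intro ext) (simp add: D_def martingale_diff_def discrete_noise_def discrete_Psi_def st_def \<zeta>_def J_def H_def U_def
        \<phi>_def \<alpha>_def \<beta>_def power2_eq_square)
  have mD: "moments_bounded Ix ?M D"
    unfolding D_eq
    by (intro moments_bounded_add moments_bounded_mult mst m\<phi> m\<beta> mgain mfb mq m\<zeta> mH m\<sigma> mmJ mmH)
  define R where "R x \<omega> = feedback (\<phi> x) (\<alpha> x) * (st (fst x) 0 \<omega> * st (fst x) 0 \<omega> + (- 1) * (st (fst x) (snd x) \<omega> * st (fst x) (snd x) \<omega>))"
    for x \<omega>
  have mst0: "moments_bounded Ix ?M (\<lambda>x. st (fst x) 0)"
    using moments_bounded_reindex[OF mst, of Ix "\<lambda>x. (fst x, 0)"] by (auto simp: Ix_def)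
  have mR: "moments_bounded Ix ?M R"
    unfolding R_def[abs_def] by (intro moments_bounded_add moments_bounded_mult mfb mst mst0 m\<sigma>)
  obtain K where K: "0 \<le> K" "\<And>x. x \<in> Ix \<Longrightarrow> (\<integral>\<omega>. D x \<omega> ^ (2*m) \<partial>?M x) \<le> K"
    using moments_boundedE[OF mD, of m] by metis
  obtain C where C: "0 \<le> C" "\<And>x. x \<in> Ix \<Longrightarrow> (\<integral>\<omega>. R x \<omega> ^ (2*m) \<partial>?M x) \<le> C"
    using moments_boundedE[OF mR, of m] by metis
  define c where "c = 2 * 4 ^ m * exp (4 ^ m :: real)"
  show thesis
  proof (rule that)
    show "0 \<le> 4 ^ m * (C + c * K)"
      using C(1) K(1) by (simp add: c_def)
    fix i N T assume i: "i \<in> I" and N: "0 < (N::nat)" and T: "1 \<le> (T::nat)"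
    define p where "p = (i, N)"
    have px: "(p, k) \<in> Ix" for k using i N by (simp add: Ix_def P_def p_def)
    interpret prob_space "M i" by (rule prob[OF i])
    define S where "S n \<omega> = (\<Sum>k<n. D (p, k) \<omega>)" for n \<omega>
    have M1: "moments_bounded {p} (\<lambda>p. M (fst p)) (\<lambda>p. Z (p, k))" if "moments_bounded Ix ?M Z" for Z k
      using moments_bounded_reindex[OF that, of "{p}" "\<lambda>p. (p, k)"] px by simp
    have pp: "prob_space (M (fst q))" if "q \<in> {p}" for q :: "'i \<times> nat"
      using that prob_space_axioms by (simp add: p_def)
    have mS: "moments_bounded {p} (\<lambda>p. M (fst p)) (\<lambda>p \<omega>. \<Sum>k<n. D (p, k) \<omega>)" for n
    proof (induction n)
      case 0
      show ?case
        unfolding lessThan_0 sum.empty by (rule moments_bounded_const[where R = 0]) (use pp in auto)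
    next
      case (Suc n)
      show ?case using moments_bounded_add[OF Suc M1[OF mD, of n]] by simp
    qed
    have intS: "integrable (M i) (\<lambda>\<omega>. S n \<omega> ^ j)" for n j
      using moments_bounded_integrable[OF moments_bounded_power[OF pp mS[of n], of j], of p] pp[of p]
      by (simp add: S_def p_def)
    have intD: "integrable (M i) (\<lambda>\<omega>. D (p, k) \<omega> ^ (2*m))" for k
      using moments_bounded_integrable_even[OF mD px] by (simp add: p_def)
    have intSD: "integrable (M i) (\<lambda>\<omega>. S n \<omega> ^ j * D (p, n) \<omega>)" for n j
      using moments_bounded_integrable[OF moments_bounded_mult[OF moments_bounded_power[OF pp mS[of n], of j] M1[OF mD, of n]], of p] pp[of p]
      by (simp add: S_def p_def)
    have intSst: "integrable (M i) (\<lambda>\<omega>. S n \<omega> ^ j * st p n \<omega>)" for n j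
      using moments_bounded_integrable[OF moments_bounded_mult[OF moments_bounded_power[OF pp mS[of n], of j] M1[OF mst, of n]], of p] pp[of p]
      by (simp add: S_def p_def)
    have D_p: "D (p, k) = martingale_diff N (f i) (a i) (b i) \<sigma> (Y i) (V i) (W i) k" for k
      by (simp add: D_def p_def \<phi>_def \<alpha>_def \<beta>_def)
    have st_p: "st p k = discrete_state N (a i) (b i) (Y i) (V i) k" for k
      by (simp add: st_def p_def)
    have "expectation (\<lambda>\<omega>. S T \<omega> ^ (2*m)) \<le> 2 * 4 ^ m * exp (4 ^ m) * K * real T ^ m"
    proof (rule martingale_even_moment[OF m, of S "\<lambda>k. D (p, k)"])
      show "expectation (\<lambda>\<omega>. S k \<omega> ^ (2*m - 1) * D (p, k) \<omega>) = 0" for k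
        unfolding D_p
      proof (rule martingale_diff_orthogonal[OF sys[OF i] N apos[OF i]])
        show "(\<lambda>\<omega>. S k \<omega> ^ (2*m - 1)) \<in> borel_measurable (history (M i) N (Y i) (V i) (W i) (past N k))"
          unfolding S_def D_p by (intro borel_measurable_power martingale_sum_history)
      qed (use intS intSst in \<open>simp_all flip: st_p\<close>)
      show "expectation (\<lambda>\<omega>. D (p, k) \<omega> ^ (2*m)) \<le> K" for k
        using K(2)[OF px, of k] by (simp add: p_def)
    qed (use intS intD intSD in \<open>simp_all add: S_def\<close>)
    then have ES: "expectation (\<lambda>\<omega>. S T \<omega> ^ (2*m)) \<le> c * K * real T ^ m"
      by (simp add: c_def)
    have intR: "integrable (M i) (\<lambda>\<omega>. R (p, T) \<omega> ^ (2*m))"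
      using moments_bounded_integrable_even[OF mR px] by (simp add: p_def)
    have ER: "expectation (\<lambda>\<omega>. R (p, T) \<omega> ^ (2*m)) \<le> C"
      using C(2)[OF px, of T] by (simp add: p_def)
    have Q: "(\<Sum>k<T. (discrete_increment N (f i) (a i) (b i) \<sigma> (Y i) (V i) (W i) k \<omega>)\<^sup>2
         - discrete_Psi N (f i) (a i) (b i) \<sigma>) = R (p, T) \<omega> + S T \<omega>" for \<omega>
      unfolding martingale_decomposition[OF apos[OF i]] S_def D_p R_def
      by (simp add: st_p) (simp add: p_def \<phi>_def \<alpha>_def power2_eq_square)
    have intQ: "integrable (M i) (\<lambda>\<omega>. (R (p, T) \<omega> + S T \<omega>) ^ (2*m))"
    proof (rule Bochner_Integration.integrable_bound)
      show "integrable (M i) (\<lambda>\<omega>. 4 ^ m * (R (p, T) \<omega> ^ (2*m) + S T \<omega> ^ (2*m)))"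
        using intR intS by simp
      have [measurable]: "R (p, T) \<in> borel_measurable (M i)"
        using moments_bounded_measurable[OF mR px, of T] by (simp add: p_def)
      have [measurable]: "S T \<in> borel_measurable (M i)"
        using borel_measurable_integrable[OF intS[of T 1]] by simp
      show "(\<lambda>\<omega>. (R (p, T) \<omega> + S T \<omega>) ^ (2*m)) \<in> borel_measurable (M i)"
        by measurable
      show "AE \<omega> in M i. norm ((R (p, T) \<omega> + S T \<omega>) ^ (2*m)) \<le> norm (4 ^ m * (R (p, T) \<omega> ^ (2*m) + S T \<omega> ^ (2*m)))"
        using even_power_sum_le[where m = m] by (intro AE_I2) (auto simp: zero_le_even_power intro: order_trans[OF _ abs_ge_self])
    qed
    have "expectation (\<lambda>\<omega>. (R (p, T) \<omega> + S T \<omega>) ^ (2*m)) \<le> expectation (\<lambda>\<omega>. 4 ^ m * (R (p, T) \<omega> ^ (2*m) + S T \<omega> ^ (2*m)))"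
      using intR intS by (intro integral_mono intQ even_power_sum_le) auto
    also have "\<dots> = 4 ^ m * (expectation (\<lambda>\<omega>. R (p, T) \<omega> ^ (2*m)) + expectation (\<lambda>\<omega>. S T \<omega> ^ (2*m)))"
      using intR intS by simp
    also have "\<dots> \<le> 4 ^ m * (C * real T ^ m + c * K * real T ^ m)"
      using ER ES C(1) one_le_power[of "real T" m] T mult_left_mono[of 1 "real T ^ m" C]
      by (intro mult_left_mono add_mono) auto
    also have "\<dots> = 4 ^ m * (C + c * K) * real T ^ m"
      by (simp add: algebra_simps)
    finally show "integrable (M i) (\<lambda>\<omega>. (\<Sum>k<T. (discrete_increment N (f i) (a i) (b i) \<sigma> (Y i) (V i) (W i) k \<omega>)\<^sup>2
         - discrete_Psi N (f i) (a i) (b i) \<sigma>) ^ (2*m)) \<and>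
     (\<integral>\<omega>. (\<Sum>k<T. (discrete_increment N (f i) (a i) (b i) \<sigma> (Y i) (V i) (W i) k \<omega>)\<^sup>2
         - discrete_Psi N (f i) (a i) (b i) \<sigma>) ^ (2*m) \<partial>M i) \<le> 4 ^ m * (C + c * K) * real T ^ m"
      unfolding Q using intQ by simp
  qed
qed

section \<open>The limit of vanishing mesh\<close>

text \<open>
  The sum is geometric.
\<close>

lemma mesh_mean_exp_limit:
  assumes c: "0 < c"
  shows "(\<lambda>n. mesh_mean (\<lambda>u. exp (- c * (1 - u))) (Suc n)) \<longlonglongrightarrow> (1 - exp (- c)) / c"
proof -
  have eq: "mesh_mean (\<lambda>u. exp (- c * (1 - u))) (Suc n)
      = (1 - exp (- c)) / (real (Suc n) * (exp (c / real (Suc n)) - 1))" for n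
  proof -
    define N where "N = Suc n"
    have N: "0 < real N" by (simp add: N_def)
    have ne: "exp (c / real N) \<noteq> 1" using c N by simp
    have "exp (- c * (1 - real i / real N)) = exp (- c) * exp (c / real N) ^ i" for i
      using N by (simp add: exp_of_nat_mult[symmetric] exp_add[symmetric] algebra_simps)
    then have "(\<Sum>i<N. exp (- c * (1 - real i / real N))) = exp (- c) * (\<Sum>i<N. exp (c / real N) ^ i)"
      by (simp add: sum_distrib_left)
    also have "\<dots> = exp (- c) * ((exp (c / real N) ^ N - 1) / (exp (c / real N) - 1))"
      by (simp add: geometric_sum[OF ne])
    also have "exp (c / real N) ^ N = exp c"
      using N by (simp flip: exp_of_nat_mult)
    also have "exp (- c) * ((exp c - 1) / (exp (c / real N) - 1)) = (1 - exp (- c)) / (exp (c / real N) - 1)"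
      by (simp add: right_diff_distrib exp_minus)
    finally show ?thesis
      by (simp add: mesh_mean_def N_def mult.commute)
  qed
  have "(\<lambda>n. real (Suc n) * (exp (c / real (Suc n)) - 1)) \<longlonglongrightarrow> c"
    using c by real_asymp
  then show ?thesis
    unfolding eq using c by (intro tendsto_divide tendsto_const) auto
qed

text \<open>
  All kernels are combinations of exponentials, so the limit is explicit; in it the powers of \<open>exp (- a)\<close>
  of second order cancel between the two variances.
\<close>

lemma discrete_Psi_limit:
  assumes a: "0 < a"
  shows "(\<lambda>n. discrete_Psi (Suc n) f a b \<sigma>) \<longlonglongrightarrow> f\<^sup>2 * b\<^sup>2 / a ^ 3 * (exp (- a) - 1 + a) + \<sigma>\<^sup>2"
proof -
  define q where "q = exp (- a)"
  have q: "0 < q" "q < 1" using a by (auto simp: q_def)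
  have q2: "exp (- (2 * a)) = q\<^sup>2" by (simp add: q_def power2_eq_square flip: exp_add)
  have dec: "(\<lambda>u. (decay a u)\<^sup>2) = (\<lambda>u. exp (- (2 * a) * (1 - u)))"
    by (intro ext) (simp add: decay_def power2_eq_square flip: exp_add)
  have resp: "mesh_mean (\<lambda>u. (response a u)\<^sup>2) (Suc n)
      = (1 - 2 * mesh_mean (\<lambda>u. exp (- a * (1 - u))) (Suc n) + mesh_mean (\<lambda>u. exp (- (2 * a) * (1 - u))) (Suc n)) / a\<^sup>2" for n
  proof -
    have *: "(response a u)\<^sup>2 = (1 - 2 * exp (- a * (1 - u)) + exp (- (2 * a) * (1 - u))) / a\<^sup>2" for u
    proof -
      have "exp (- (2 * a) * (1 - u)) = exp (- a * (1 - u)) * exp (- a * (1 - u))"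
        by (simp flip: exp_add)
      then show ?thesis
        by (simp only: response_def power2_eq_square) (simp add: algebra_simps)
    qed
    define N where "N = Suc n"
    have N: "0 < real N" by (simp add: N_def)
    have "(\<Sum>i<N. (response a (real i / real N))\<^sup>2)
        = (real N - 2 * (\<Sum>i<N. exp (- a * (1 - real i / real N))) + (\<Sum>i<N. exp (- (2 * a) * (1 - real i / real N)))) / a\<^sup>2"
      unfolding * by (simp add: sum_divide_distrib[symmetric] sum.distrib sum_subtractf sum_distrib_left[symmetric])
    moreover have "(real N - 2 * S + S') / a\<^sup>2 / real N = (1 - 2 * (S / real N) + S' / real N) / a\<^sup>2" for S S'
      using N a by (simp add: field_simps)
    ultimately show ?thesis
      unfolding mesh_mean_def N_def[symmetric] by (simp only:)
  qed
  have lim: "(\<lambda>n. discrete_Psi (Suc n) f a b \<sigma>) \<longlonglongrightarrow>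
     (f * b)\<^sup>2 * ((1 - 2 * ((1 - exp (- a)) / a) + (1 - exp (- (2 * a))) / (2 * a)) / a\<^sup>2) + \<sigma>\<^sup>2
       + feedback f a * (b\<^sup>2 * ((1 - exp (- (2 * a))) / (2 * a)))"
    unfolding discrete_Psi_def resp dec
    using a by (intro tendsto_intros mesh_mean_exp_limit) auto
  have value_eq: "(f * b)\<^sup>2 * ((1 - 2 * ((1 - exp (- a)) / a) + (1 - exp (- (2 * a))) / (2 * a)) / a\<^sup>2) + \<sigma>\<^sup>2
       + feedback f a * (b\<^sup>2 * ((1 - exp (- (2 * a))) / (2 * a)))
     = f\<^sup>2 * b\<^sup>2 / a ^ 3 * (exp (- a) - 1 + a) + \<sigma>\<^sup>2"
  proof -
    have fb: "feedback f a * (b\<^sup>2 * ((1 - q\<^sup>2) / (2 * a))) = f\<^sup>2 * b\<^sup>2 * (1 - q)\<^sup>2 / (2 * a ^ 3)"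
    proof -
      have "q\<^sup>2 < 1" using q by (simp add: power_less_one_iff abs_square_less_1)
      then have "feedback f a * (b\<^sup>2 * ((1 - q\<^sup>2) / (2 * a))) = (gain f a)\<^sup>2 * (b\<^sup>2 / (2 * a))"
        by (simp add: feedback_def q_def[symmetric])
      also have "\<dots> = f\<^sup>2 * b\<^sup>2 * (1 - q)\<^sup>2 / (2 * a ^ 3)"
        by (simp add: gain_def q_def[symmetric] power_mult_distrib power_divide power2_eq_square power3_eq_cube ac_simps)
      finally show ?thesis .
    qed
    have "(f * b)\<^sup>2 * ((1 - 2 * ((1 - q) / a) + (1 - q\<^sup>2) / (2 * a)) / a\<^sup>2) + f\<^sup>2 * b\<^sup>2 * (1 - q)\<^sup>2 / (2 * a ^ 3)
       = f\<^sup>2 * b\<^sup>2 / a ^ 3 * (q - 1 + a)"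
      using a by (simp add: field_simps power2_eq_square power3_eq_cube)
    then show ?thesis
      unfolding q2 q_def[symmetric] fb by simp
  qed
  show ?thesis using lim unfolding value_eq .
qed

text \<open>
  With \<open>e t = exp (- a * (k + 1 - t))\<close> the increments of \<open>e * Y\<close> telescope to the limit. On a mesh interval
  from \<open>t\<close> to \<open>t'\<close> such an increment differs from \<open>b * e t * (V t' - V t)\<close> by the integral of
  \<open>a * (e t * Y s - e s * Y t')\<close>, because \<open>e\<close> and \<open>Y\<close> satisfy their respective equations. Uniform continuity of
  \<open>(s, t) \<mapsto> e s * Y t\<close> makes the integrand small.
\<close>

lemma wiener_sum_decay_limit:
  assumes cont: "continuous_on {0..} (\<lambda>t. Y t \<omega>)"
    and eq: "\<And>t. 0 \<le> t \<Longrightarrow> Y t \<omega> = Y 0 \<omega> - a * integral {0..t} (\<lambda>s. Y s \<omega>) + b * V t \<omega>"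
    and a: "0 < a"
  shows "(\<lambda>n. b * wiener_sum (decay a) (Suc n) V k \<omega>) \<longlonglongrightarrow> Y (real (Suc k)) \<omega> - exp (- a) * Y (real k) \<omega>"
proof (rule LIMSEQ_I)
  fix r :: real assume r: "0 < r"
  define y where "y t = Y t \<omega>" for t
  define e where "e t = exp (- a * (real (Suc k) - t))" for t
  define I where "I = {real k..real (Suc k)}"
  have I0: "I \<subseteq> {0..}" by (auto simp: I_def)
  have cont_y: "continuous_on S y" if "S \<subseteq> {0..}" for S
    unfolding y_def using continuous_on_subset[OF cont that] .
  have cont_e: "continuous_on S e" for S
    unfolding e_def by (intro continuous_intros)
  have "uniformly_continuous_on (I \<times> I) (\<lambda>z. e (fst z) * y (snd z))"
  proof (rule compact_uniformly_continuous)
    show "compact (I \<times> I)" by (auto simp: I_def intro: compact_Times)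
    have "continuous_on (I \<times> I) (\<lambda>z. e (fst z))" "continuous_on (I \<times> I) (\<lambda>z. y (snd z))"
      by (rule continuous_on_compose2[OF cont_e[of I]] continuous_on_compose2[OF cont_y[OF I0]]; auto intro: continuous_intros)+
    then show "continuous_on (I \<times> I) (\<lambda>z. e (fst z) * y (snd z))"
      by (intro continuous_on_mult)
  qed
  moreover have "0 < r / (2 * a)" using r a by simp
  ultimately obtain \<delta> where \<delta>: "0 < \<delta>"
    and uc: "\<And>z z'. z \<in> I \<times> I \<Longrightarrow> z' \<in> I \<times> I \<Longrightarrow> dist z' z < \<delta> \<Longrightarrow>
        dist (e (fst z') * y (snd z')) (e (fst z) * y (snd z)) < r / (2 * a)"
    unfolding uniformly_continuous_on_def by blast
  obtain n\<^sub>0 where n0: "1 / real (Suc n\<^sub>0) < \<delta>"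
    using nat_approx_posE[OF \<delta>] by blast
  show "\<exists>no. \<forall>n\<ge>no. norm (b * wiener_sum (decay a) (Suc n) V k \<omega> - (Y (real (Suc k)) \<omega> - exp (- a) * Y (real k) \<omega>)) < r"
  proof (intro exI[of _ n\<^sub>0] allI impI)
    fix n assume n: "n\<^sub>0 \<le> n"
    define N where "N = Suc n"
    have N: "0 < real N" by (simp add: N_def)
    have "1 / real N \<le> 1 / real (Suc n\<^sub>0)"
      using n by (intro divide_left_mono) (auto simp: N_def)
    then have N\<delta>: "1 / real N < \<delta>" using n0 by linarith
    define t where "t i = real (k * N + i) / real N" for i
    have t_eq: "t i = real k + real i / real N" for i
      using N by (simp add: t_def add_divide_distrib)
    have t_Suc: "t (Suc i) = t i + 1 / real N" for i
      by (simp add: t_eq add_divide_distrib)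
    have t0: "0 \<le> t i" for i by (simp add: t_def)
    have y_eq: "y u = y 0 - a * integral {0..u} y + b * V u \<omega>" if "0 \<le> u" for u
      using eq[OF that] unfolding y_def[abs_def] .
    have t_I: "t i \<in> I" if "i \<le> N" for i
      using that N by (simp add: t_eq I_def)
    have dec: "decay a (real i / real N) = e (t i)" for i
      by (simp add: decay_def e_def t_eq algebra_simps)
    define \<rho> where "\<rho> i = b * (e (t i) * (V (t (Suc i)) \<omega> - V (t i) \<omega>)) - (e (t (Suc i)) * y (t (Suc i)) - e (t i) * y (t i))" for i
    have \<rho>: "\<bar>\<rho> i\<bar> \<le> r / (2 * real N)" if i: "i < N" for i
    proof -
      let ?J = "{t i..t (Suc i)}"
      have le: "t i \<le> t (Suc i)" using N by (simp add: t_Suc)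
      have J0: "?J \<subseteq> {0..}" using t0[of i] by auto
      have JI: "?J \<subseteq> I" using t_I[of i] t_I[of "Suc i"] i by (auto simp: I_def)
      have int_y: "y integrable_on {s..u}" if "0 \<le> s" for s u
        using that by (intro integrable_continuous_interval cont_y) auto
      have comb: "integral {0..t i} y + integral ?J y = integral {0..t (Suc i)} y"
        using t0[of i] le int_y[of 0] by (intro Henstock_Kurzweil_Integration.integral_combine) auto
      have "a * integral {0..t (Suc i)} y = a * integral {0..t i} y + a * integral ?J y"
        unfolding comb[symmetric] by (rule distrib_left)
      moreover note y_eq[OF t0[of i]] y_eq[OF t0[of "Suc i"]]
      ultimately have bV: "b * (V (t (Suc i)) \<omega> - V (t i) \<omega>) = y (t (Suc i)) - y (t i) + a * integral ?J y"
        unfolding right_diff_distrib by linarith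
      have hy: "(y has_integral integral ?J y) ?J"
        using int_y t0[of i] by (intro integrable_integral) auto
      have he: "((\<lambda>s. a * e s) has_integral (e (t (Suc i)) - e (t i))) ?J"
      proof (rule fundamental_theorem_of_calculus[OF le])
        fix s
        have "(e has_real_derivative a * e s) (at s within ?J)"
          unfolding e_def by (auto intro!: derivative_eq_intros)
        then show "(e has_vector_derivative a * e s) (at s within ?J)"
          by (simp add: has_real_derivative_iff_has_vector_derivative)
      qed
      have "((\<lambda>s. a * e (t i) * y s - a * e s * y (t (Suc i))) has_integral
          (a * e (t i) * integral ?J y - (e (t (Suc i)) - e (t i)) * y (t (Suc i)))) ?J"
        by (intro has_integral_diff has_integral_mult_right has_integral_mult_left hy he)
      moreover have "a * e (t i) * integral ?J y - (e (t (Suc i)) - e (t i)) * y (t (Suc i)) = \<rho> i"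
      proof -
        have "b * (e (t i) * (V (t (Suc i)) \<omega> - V (t i) \<omega>)) = e (t i) * (b * (V (t (Suc i)) \<omega> - V (t i) \<omega>))"
          by simp
        then show ?thesis
          unfolding \<rho>_def bV by (simp add: algebra_simps)
      qed
      ultimately have hi: "((\<lambda>s. a * e (t i) * y s - a * e s * y (t (Suc i))) has_integral \<rho> i) ?J" by simp
      have "norm (a * e (t i) * y s - a * e s * y (t (Suc i))) \<le> r / 2" if s: "s \<in> ?J" for s
      proof -
        \<comment> \<open>The two coordinates move by complementary parts of one mesh interval.\<close>
        have "dist (t i, s) (s, t (Suc i)) = sqrt ((t i - s)\<^sup>2 + (s - t (Suc i))\<^sup>2)"
          by (simp add: dist_Pair_Pair dist_real_def)
        also have "\<dots> \<le> \<bar>t i - s\<bar> + \<bar>s - t (Suc i)\<bar>"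
          by (rule sqrt_sum_squares_le_sum_abs)
        also have "\<dots> = 1 / real N" using s by (simp add: t_Suc)
        finally have "dist (t i, s) (s, t (Suc i)) < \<delta>" using N\<delta> by linarith
        then have "\<bar>e (t i) * y s - e s * y (t (Suc i))\<bar> < r / (2 * a)"
          using uc[of "(s, t (Suc i))" "(t i, s)"] s JI t_I[of i] t_I[of "Suc i"] i
          by (auto simp: dist_real_def)
        then have "a * \<bar>e (t i) * y s - e s * y (t (Suc i))\<bar> \<le> a * (r / (2 * a))"
          using a by (intro mult_left_mono) auto
        moreover have "a * \<bar>e (t i) * y s - e s * y (t (Suc i))\<bar> = \<bar>a * e (t i) * y s - a * e s * y (t (Suc i))\<bar>"
        proof -
          have "a * e (t i) * y s - a * e s * y (t (Suc i)) = a * (e (t i) * y s - e s * y (t (Suc i)))"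
            by (simp add: right_diff_distrib)
          then show ?thesis using a by (simp add: abs_mult)
        qed
        ultimately show ?thesis using a by simp
      qed
      then have "norm (\<rho> i) \<le> r / 2 * Henstock_Kurzweil_Integration.content ?J"
        using r by (intro has_integral_bound_real[OF _ finite.emptyI hi]) auto
      then show ?thesis
        using le by (simp add: t_Suc)
    qed
    have "b * wiener_sum (decay a) N V k \<omega> = (\<Sum>i<N. b * (e (t i) * (V (t (Suc i)) \<omega> - V (t i) \<omega>)))"
      by (simp add: wiener_sum_def dec sum_distrib_left t_def)
    also have "\<dots> = (\<Sum>i<N. \<rho> i) + (\<Sum>i<N. e (t (Suc i)) * y (t (Suc i)) - e (t i) * y (t i))"
      by (simp add: \<rho>_def flip: sum.distrib)
    also have "(\<Sum>i<N. e (t (Suc i)) * y (t (Suc i)) - e (t i) * y (t i)) = e (t N) * y (t N) - e (t 0) * y (t 0)"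
      by (rule sum_lessThan_telescope)
    also have "\<dots> = Y (real (Suc k)) \<omega> - exp (- a) * Y (real k) \<omega>"
      using N by (simp add: t_eq e_def y_def add.commute)
    finally have "\<bar>b * wiener_sum (decay a) N V k \<omega> - (Y (real (Suc k)) \<omega> - exp (- a) * Y (real k) \<omega>)\<bar> = \<bar>\<Sum>i<N. \<rho> i\<bar>"
      by simp
    also have "\<dots> \<le> (\<Sum>i<N. \<bar>\<rho> i\<bar>)" by (rule sum_abs)
    also have "\<dots> \<le> (\<Sum>i<N. r / (2 * real N))" by (intro sum_mono \<rho>) auto
    also have "\<dots> = r / 2" using N by simp
    also have "\<dots> < r" using r by simp
    finally show "norm (b * wiener_sum (decay a) (Suc n) V k \<omega> - (Y (real (Suc k)) \<omega> - exp (- a) * Y (real k) \<omega>)) < r"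
      by (simp add: N_def)
  qed
qed

text \<open>
  The kernels satisfy \<open>response a u = (1 - decay a u) / a\<close>, and for the constant kernel the sum telescopes.
  Hence one limit takes care of both kernels.
\<close>

lemma wiener_sum_response:
  assumes a: "0 < a" and N: "0 < N"
  shows "wiener_sum (response a) N V k \<omega>
    = (V (real (Suc k)) \<omega> - V (real k) \<omega> - wiener_sum (decay a) N V k \<omega>) / a"
proof -
  define v where "v i = V (real (k*N + i) / real N) \<omega>" for i
  have "(\<Sum>i<N. v (Suc i) - v i) = v N - v 0"
    by (rule sum_lessThan_telescope)
  also have "\<dots> = V (real (Suc k)) \<omega> - V (real k) \<omega>"
  proof -
    have "real (k*N + N) / real N = real (Suc k)" "real (k*N + 0) / real N = real k"
      using N by (simp_all add: field_simps)
    then show ?thesis by (simp only: v_def)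
  qed
  finally have tel: "(\<Sum>i<N. v (Suc i) - v i) = V (real (Suc k)) \<omega> - V (real k) \<omega>" .
  have "wiener_sum (response a) N V k \<omega> = (\<Sum>i<N. ((v (Suc i) - v i) - decay a (real i / real N) * (v (Suc i) - v i)) / a)"
    unfolding wiener_sum_def by (intro sum.cong refl) (simp add: response_def decay_def v_def left_diff_distrib)
  also have "\<dots> = ((\<Sum>i<N. v (Suc i) - v i) - wiener_sum (decay a) N V k \<omega>) / a"
    by (simp add: sum_divide_distrib[symmetric] sum_subtractf wiener_sum_def v_def)
  finally show ?thesis unfolding tel .
qed

lemma discrete_state_limit:
  assumes cont: "continuous_on {0..} (\<lambda>t. Y t \<omega>)"
    and eq: "\<And>t. 0 \<le> t \<Longrightarrow> Y t \<omega> = Y 0 \<omega> - a * integral {0..t} (\<lambda>s. Y s \<omega>) + b * V t \<omega>"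
    and a: "0 < a"
  shows "(\<lambda>n. discrete_state (Suc n) a b Y V k \<omega>) \<longlonglongrightarrow> Y (real k) \<omega>"
proof (induction k)
  case 0
  show ?case by simp
next
  case (Suc k)
  have "(\<lambda>n. exp (- a) * discrete_state (Suc n) a b Y V k \<omega> + b * wiener_sum (decay a) (Suc n) V k \<omega>)
      \<longlonglongrightarrow> exp (- a) * Y (real k) \<omega> + (Y (real (Suc k)) \<omega> - exp (- a) * Y (real k) \<omega>)"
    by (intro tendsto_intros Suc wiener_sum_decay_limit[where Y = Y and V = V and \<omega> = \<omega>, OF cont eq a])
  then show ?case by simp
qed

text \<open>
  The equation for \<open>Y\<close> expresses \<open>b * (V (k + 1) - V k)\<close> by the increment of \<open>Y\<close> and its integral. After
  substitution the values of \<open>Y\<close> cancel and \<open>f\<close> times the integral is left.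
\<close>

lemma discrete_increment_limit:
  assumes cont: "continuous_on {0..} (\<lambda>t. Y t \<omega>)"
    and eqY: "\<And>t. 0 \<le> t \<Longrightarrow> Y t \<omega> = Y 0 \<omega> - a * integral {0..t} (\<lambda>s. Y s \<omega>) + b * V t \<omega>"
    and eqX: "\<And>t. 0 \<le> t \<Longrightarrow> X t \<omega> = X 0 \<omega> + f * integral {0..t} (\<lambda>s. Y s \<omega>) + \<sigma> * W t \<omega>"
    and a: "0 < a"
  shows "(\<lambda>n. discrete_increment (Suc n) f a b \<sigma> Y V W k \<omega>) \<longlonglongrightarrow> X (real (Suc k)) \<omega> - X (real k) \<omega>"
proof -
  define \<Delta>V where "\<Delta>V = V (real (Suc k)) \<omega> - V (real k) \<omega>"
  define \<Delta>W where "\<Delta>W = W (real (Suc k)) \<omega> - W (real k) \<omega>"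
  define \<Delta>I where "\<Delta>I = integral {0..real (Suc k)} (\<lambda>s. Y s \<omega>) - integral {0..real k} (\<lambda>s. Y s \<omega>)"
  have incr: "discrete_increment (Suc n) f a b \<sigma> Y V W k \<omega>
     = gain f a * discrete_state (Suc n) a b Y V k \<omega> + f * ((b * \<Delta>V - b * wiener_sum (decay a) (Suc n) V k \<omega>) / a) + \<sigma> * \<Delta>W" for n
    using a by (simp add: discrete_increment_def discrete_noise_def wiener_sum_response \<Delta>V_def \<Delta>W_def right_diff_distrib)
  have lim: "(\<lambda>n. discrete_increment (Suc n) f a b \<sigma> Y V W k \<omega>) \<longlonglongrightarrow>
     gain f a * Y (real k) \<omega> + f * ((b * \<Delta>V - (Y (real (Suc k)) \<omega> - exp (- a) * Y (real k) \<omega>)) / a) + \<sigma> * \<Delta>W"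
    unfolding incr using a
    by (intro tendsto_intros discrete_state_limit[where Y = Y and V = V and \<omega> = \<omega>, OF cont eqY a] wiener_sum_decay_limit[where Y = Y and V = V and \<omega> = \<omega>, OF cont eqY a]) auto
  have "gain f a * Y (real k) \<omega> + f * ((b * \<Delta>V - (Y (real (Suc k)) \<omega> - exp (- a) * Y (real k) \<omega>)) / a) + \<sigma> * \<Delta>W
      = f * \<Delta>I + \<sigma> * \<Delta>W"
  proof -
    have "Y (real (Suc k)) \<omega> - Y (real k) \<omega> = b * \<Delta>V - a * \<Delta>I"
      using eqY[of "real (Suc k)"] eqY[of "real k"] by (simp add: \<Delta>V_def \<Delta>I_def right_diff_distrib)
    then have *: "b * \<Delta>V - (Y (real (Suc k)) \<omega> - exp (- a) * Y (real k) \<omega>) = a * \<Delta>I - (1 - exp (- a)) * Y (real k) \<omega>"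
      by (simp add: algebra_simps)
    show ?thesis
      unfolding gain_def * using a by (simp add: field_simps)
  qed
  also have "\<dots> = X (real (Suc k)) \<omega> - X (real k) \<omega>"
    using eqX[of "real (Suc k)"] eqX[of "real k"] by (simp add: \<Delta>I_def \<Delta>W_def right_diff_distrib)
  finally show ?thesis using lim by simp
qed

lemma R1_eq:
  assumes "1 \<le> T"
  shows "real T * (R1 T (path_on {0..real T} X \<omega>) - c) = (\<Sum>k<T. (X (real (Suc k)) \<omega> - X (real k) \<omega>)\<^sup>2 - c)"
proof -
  have "(\<Sum>k=1..T. (path_on {0..real T} X \<omega> (real k) - path_on {0..real T} X \<omega> (real (k - 1)))\<^sup>2)
      = (\<Sum>k<T. (X (real (Suc k)) \<omega> - X (real k) \<omega>)\<^sup>2)"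
    by (rule sum.reindex_bij_witness[of _ Suc "\<lambda>k. k - 1"]) auto
  then show ?thesis
    using assms by (simp add: R1_def sum_subtractf right_diff_distrib)
qed

text \<open>
  The lemma of Fatou, applied along meshes of width \<open>1 / (n + 1)\<close>.
\<close>

lemma R1_moment_bound:
  assumes sys: "partially_observed_system M f a b \<sigma> d\<^sub>x d\<^sub>y W V X Y" and a: "0 < a" and T: "1 \<le> T"
    and bound: "\<And>N. 0 < N \<Longrightarrow>
     integrable M (\<lambda>\<omega>. (\<Sum>k<T. (discrete_increment N f a b \<sigma> Y V W k \<omega>)\<^sup>2 - discrete_Psi N f a b \<sigma>) ^ (2*m)) \<and>
     (\<integral>\<omega>. (\<Sum>k<T. (discrete_increment N f a b \<sigma> Y V W k \<omega>)\<^sup>2 - discrete_Psi N f a b \<sigma>) ^ (2*m) \<partial>M) \<le> K"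
  shows "(\<integral>\<^sup>+\<omega>. ennreal ((real T * (R1 T (path_on {0..real T} X \<omega>)
       - (f\<^sup>2 * b\<^sup>2 / a ^ 3 * (exp (- a) - 1 + a) + \<sigma>\<^sup>2))) ^ (2*m)) \<partial>M) \<le> ennreal K"
proof -
  define \<Psi> where "\<Psi> = f\<^sup>2 * b\<^sup>2 / a ^ 3 * (exp (- a) - 1 + a) + \<sigma>\<^sup>2"
  define Q where "Q n \<omega> = (\<Sum>k<T. (discrete_increment (Suc n) f a b \<sigma> Y V W k \<omega>)\<^sup>2 - discrete_Psi (Suc n) f a b \<sigma>) ^ (2*m)" for n \<omega>
  define L where "L \<omega> = (real T * (R1 T (path_on {0..real T} X \<omega>) - \<Psi>)) ^ (2*m)" for \<omega>
  have "AE \<omega> in M. continuous_on {0..} (\<lambda>t. Y t \<omega>)"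
    and "AE \<omega> in M. \<forall>t\<ge>0. X t \<omega> = X 0 \<omega> + f * integral {0..t} (\<lambda>s. Y s \<omega>) + \<sigma> * W t \<omega>"
    and "AE \<omega> in M. \<forall>t\<ge>0. Y t \<omega> = Y 0 \<omega> - a * integral {0..t} (\<lambda>s. Y s \<omega>) + b * V t \<omega>"
    using sys unfolding partially_observed_system_def by auto
  then have "AE \<omega> in M. (\<lambda>n. Q n \<omega>) \<longlonglongrightarrow> L \<omega>"
  proof eventually_elim
    case (elim \<omega>)
    have "(\<lambda>n. discrete_increment (Suc n) f a b \<sigma> Y V W k \<omega>) \<longlonglongrightarrow> X (real (Suc k)) \<omega> - X (real k) \<omega>" for k
      using elim by (intro discrete_increment_limit a) blast+
    then show ?case
      unfolding Q_def L_def R1_eq[OF T] \<Psi>_def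
      by (intro tendsto_intros discrete_Psi_limit a)
  qed
  then have "AE \<omega> in M. liminf (\<lambda>n. ennreal (Q n \<omega>)) = ennreal (L \<omega>)"
    by eventually_elim (auto intro!: lim_imp_Liminf)
  then have "(\<integral>\<^sup>+\<omega>. ennreal (L \<omega>) \<partial>M) = (\<integral>\<^sup>+\<omega>. liminf (\<lambda>n. ennreal (Q n \<omega>)) \<partial>M)"
    by (intro nn_integral_cong_AE) auto
  also have "\<dots> \<le> liminf (\<lambda>n. \<integral>\<^sup>+\<omega>. ennreal (Q n \<omega>) \<partial>M)"
  proof (rule nn_integral_liminf)
    show "(\<lambda>\<omega>. ennreal (Q n \<omega>)) \<in> borel_measurable M" for n
      using bound[of "Suc n"] unfolding Q_def by (auto dest!: borel_measurable_integrable)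
  qed
  also have "\<dots> \<le> liminf (\<lambda>n. ennreal K)"
  proof (intro Liminf_mono always_eventually allI)
    fix n
    have int: "integrable M (Q n)" and le: "integral\<^sup>L M (Q n) \<le> K"
      using bound[of "Suc n"] unfolding Q_def[abs_def] by auto
    have "(\<integral>\<^sup>+\<omega>. ennreal (Q n \<omega>) \<partial>M) = ennreal (integral\<^sup>L M (Q n))"
      by (intro nn_integral_eq_integral int) (auto simp: Q_def zero_le_even_power)
    then show "(\<integral>\<^sup>+\<omega>. ennreal (Q n \<omega>) \<partial>M) \<le> ennreal K"
      using le by (simp add: ennreal_leI)
  qed
  also have "\<dots> = ennreal K" by (simp add: Liminf_const)
  finally show ?thesis unfolding L_def \<Psi>_def .
qed

section \<open>From the statistic to the estimator\<close>

lemma twice_cont_diff_on_continuous: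
  "twice_cont_diff_on g S \<Longrightarrow> continuous_on S g"
  unfolding twice_cont_diff_on_def
  by (blast intro: DERIV_continuous_on)

lemma twice_cont_diff_on_interior:
  assumes "twice_cont_diff_on g {\<alpha>..\<beta>}" "x \<in> {\<alpha><..<\<beta>}"
  obtains D where "(g has_real_derivative D) (at x)"
proof -
  from assms obtain g' where "(g has_real_derivative g' x) (at x within {\<alpha>..\<beta>})"
    unfolding twice_cont_diff_on_def by (metis atLeastAtMost_iff greaterThanLessThan_iff less_eq_real_def)
  moreover have "at x within {\<alpha>..\<beta>} = at x"
    using assms(2) by (intro at_within_interior) (auto simp: interior_atLeastAtMost_real)
  ultimately show ?thesis using that by simp
qed

lemma continuous_bounded_Icc:
  fixes g :: "real \<Rightarrow> real"
  assumes "continuous_on {\<alpha>..\<beta>} g"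
  obtains C where "\<And>x. x \<in> {\<alpha>..\<beta>} \<Longrightarrow> \<bar>g x\<bar> \<le> C"
proof -
  have "bounded (g ` {\<alpha>..\<beta>})"
    by (intro compact_imp_bounded compact_continuous_image assms) auto
  then obtain C where "\<forall>y\<in>g ` {\<alpha>..\<beta>}. norm y \<le> C"
    unfolding bounded_iff by blast
  then show ?thesis by (intro that[of C]) auto
qed

lemma Psi_differentiable:
  assumes "twice_cont_diff_on f {\<alpha>..\<beta>}" "twice_cont_diff_on a {\<alpha>..\<beta>}" "twice_cont_diff_on b {\<alpha>..\<beta>}"
    and "a x \<noteq> 0" and x: "x \<in> {\<alpha><..<\<beta>}"
  shows "(Psi f a b \<sigma> has_real_derivative deriv (Psi f a b \<sigma>) x) (at x)"
proof -
  obtain f' a' b' where [derivative_intros]: "(f has_real_derivative f') (at x)"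
    "(a has_real_derivative a') (at x)" "(b has_real_derivative b') (at x)"
    using twice_cont_diff_on_interior[OF _ x] assms(1-3) by metis
  have "\<exists>D. (Psi f a b \<sigma> has_real_derivative D) (at x)"
    unfolding Psi_def[abs_def] using assms(4) by (intro exI) (rule derivative_eq_intros | simp)+
  then show ?thesis
    using DERIV_imp_deriv by blast
qed

lemma Psi_continuous:
  assumes "twice_cont_diff_on f S" "twice_cont_diff_on a S" "twice_cont_diff_on b S"
    and "\<And>x. x \<in> S \<Longrightarrow> a x \<noteq> 0"
  shows "continuous_on S (Psi f a b \<sigma>)"
  unfolding Psi_def[abs_def] using assms
  by (intro continuous_intros twice_cont_diff_on_continuous) auto

text \<open>
  The mean value theorem needs the derivative inside the interval only, so that the endpoints, at which the
  estimator may lie, are covered by continuity.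
\<close>

lemma expanding_if_deriv_bounded_below:
  assumes cont: "continuous_on {\<alpha>..\<beta>} g"
    and deriv: "\<And>x. x \<in> {\<alpha><..<\<beta>} \<Longrightarrow> (g has_real_derivative deriv g x) (at x)"
    and c: "\<And>x. x \<in> {\<alpha><..<\<beta>} \<Longrightarrow> c \<le> \<bar>deriv g x\<bar>"
    and "x \<in> {\<alpha>..\<beta>}" "y \<in> {\<alpha>..\<beta>}"
  shows "c * \<bar>x - y\<bar> \<le> \<bar>g x - g y\<bar>"
  using assms(4,5)
proof (induction x y rule: linorder_wlog)
  case (sym x y)
  then show ?case by (simp add: abs_minus_commute)
next
  case (le x y)
  show ?case
  proof (cases "x = y")
    case False
    then have "x < y" using le by simp
    moreover have "continuous_on {x..y} g"
      using le by (intro continuous_on_subset[OF cont]) auto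
    moreover have "(g has_derivative (\<lambda>h. deriv g z * h)) (at z)" if "x < z" "z < y" for z
      using deriv[of z] that le by (auto simp: has_field_derivative_def)
    ultimately obtain z where z: "x < z" "z < y" "g y - g x = deriv g z * (y - x)"
      using mvt[of x y g "\<lambda>z h. deriv g z * h"] by blast
    then have "\<bar>g x - g y\<bar> = \<bar>deriv g z\<bar> * \<bar>x - y\<bar>"
      by (metis abs_minus_commute abs_mult)
    moreover have "c \<le> \<bar>deriv g z\<bar>"
      using c z le by auto
    ultimately show ?thesis by (simp add: mult_right_mono)
  qed simp
qed

text \<open>
  The minimal distance is at most the distance at the true value; the triangle inequality then gives the
  factor \<open>2\<close>.
\<close>

lemma moment_estimator_error:
  assumes est: "moment_estimator \<alpha> \<beta> \<Psi> est" and T: "1 \<le> T" and x: "x \<in> space (path_space {0..real T})"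
    and expand: "\<And>u v. u \<in> {\<alpha>..\<beta>} \<Longrightarrow> v \<in> {\<alpha>..\<beta>} \<Longrightarrow> c * \<bar>u - v\<bar> \<le> \<bar>\<Psi> u - \<Psi> v\<bar>"
    and c: "0 < c" and \<theta>: "\<theta> \<in> {\<alpha><..<\<beta>}"
  shows "\<bar>est T x - \<theta>\<bar> \<le> 2 / c * \<bar>R1 T x - \<Psi> \<theta>\<bar>"
proof -
  define m where "m = (INF \<theta>\<in>{\<alpha><..<\<beta>}. \<bar>R1 T x - \<Psi> \<theta>\<bar>)"
  have e: "\<bar>R1 T x - \<Psi> (est T x)\<bar> = m"
    "est T x \<in> (if \<exists>\<theta>\<in>{\<alpha><..<\<beta>}. \<bar>R1 T x - \<Psi> \<theta>\<bar> = m then {\<alpha><..<\<beta>} else {\<alpha>, \<beta>})"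
    using est T x unfolding moment_estimator_def m_def Let_def by blast+
  have "est T x \<in> {\<alpha>..\<beta>}"
    using e(2) \<theta> by (auto split: if_splits)
  then have "c * \<bar>est T x - \<theta>\<bar> \<le> \<bar>\<Psi> (est T x) - \<Psi> \<theta>\<bar>"
    using \<theta> by (intro expand) auto
  also have "\<dots> \<le> \<bar>R1 T x - \<Psi> \<theta>\<bar> + \<bar>R1 T x - \<Psi> (est T x)\<bar>"
    using abs_triangle_ineq4[of "R1 T x - \<Psi> \<theta>" "R1 T x - \<Psi> (est T x)"] by simp
  also have "\<dots> = \<bar>R1 T x - \<Psi> \<theta>\<bar> + m"
    using e(1) by simp
  also have "m \<le> \<bar>R1 T x - \<Psi> \<theta>\<bar>"
    unfolding m_def by (rule cINF_lower[OF _ \<theta>]) (auto intro!: bdd_belowI[of _ 0])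
  finally have "c * \<bar>est T x - \<theta>\<bar> \<le> 2 * \<bar>R1 T x - \<Psi> \<theta>\<bar>"
    by simp
  then show ?thesis using c by (simp add: field_simps)
qed

lemma estimator_measurable:
  assumes est: "moment_estimator \<alpha> \<beta> \<Psi> est" and T: "1 \<le> T" and X: "\<And>t. 0 \<le> t \<Longrightarrow> X t \<in> borel_measurable M"
  shows "(\<lambda>\<omega>. est T (path_on {0..real T} X \<omega>)) \<in> borel_measurable M"
proof -
  have "est T \<in> borel_measurable (path_space {0..real T})"
    using est T unfolding moment_estimator_def by auto
  moreover have "(\<lambda>\<omega>. path_on {0..real T} X \<omega>) \<in> M \<rightarrow>\<^sub>M path_space {0..real T}"
    using X by (intro measurable_restrict) auto
  ultimately show ?thesis by (rule measurable_compose_rev)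
qed

lemma R1_measurable:
  assumes "\<And>t. 0 \<le> t \<Longrightarrow> X t \<in> borel_measurable M"
  shows "(\<lambda>\<omega>. R1 T (path_on {0..real T} X \<omega>)) \<in> borel_measurable M"
proof -
  have "(\<lambda>\<omega>. path_on {0..real T} X \<omega> t) \<in> borel_measurable M" for t
    using assms[of t] by (cases "t \<in> {0..real T}") auto
  then show ?thesis
    unfolding R1_def
    by (intro borel_measurable_times borel_measurable_const borel_measurable_sum borel_measurable_power borel_measurable_diff)
qed

text \<open>
  Reduces moments of a real order to even integer ones.
\<close>

lemma powr_le_one_plus_even_power:
  fixes x p :: real
  assumes "0 \<le> x" "0 \<le> p" "p \<le> 2 * real m"
  shows "x powr p \<le> 1 + x ^ (2*m)"
proof (cases "x \<le> 1")
  case True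
  then have "x powr p \<le> 1 powr p" using assms by (intro powr_mono2) auto
  then show ?thesis using assms by (simp add: add_increasing2)
next
  case False
  then have "x powr p \<le> x powr real (2*m)" using assms by (intro powr_mono) auto
  also have "\<dots> = x ^ (2*m)" using False by (subst powr_realpow) auto
  finally show ?thesis by simp
qed

theorem proposition2:
  fixes \<alpha> \<beta> \<sigma> d\<^sub>x d\<^sub>y :: real
    and f a b :: "real \<Rightarrow> real"
    and M :: "real \<Rightarrow> 'a measure"
    and W V X Y :: "real \<Rightarrow> real \<Rightarrow> 'a \<Rightarrow> real"
    and est :: "nat \<Rightarrow> (real \<Rightarrow> real) \<Rightarrow> real"
  assumes "\<alpha> < \<beta>" and "\<sigma> > 0"
    and "twice_cont_diff_on f {\<alpha>..\<beta>}"
    and "twice_cont_diff_on a {\<alpha>..\<beta>}"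
    and "twice_cont_diff_on b {\<alpha>..\<beta>}"
    and "\<And>\<theta>. \<theta> \<in> {\<alpha>..\<beta>} \<Longrightarrow> a \<theta> > 0"
    and "(INF \<theta>\<in>{\<alpha><..<\<beta>}. \<bar>deriv (Psi f a b \<sigma>) \<theta>\<bar>) > 0"
    and "\<And>\<theta>. \<theta> \<in> {\<alpha><..<\<beta>} \<Longrightarrow>
           partially_observed_system (M \<theta>) (f \<theta>) (a \<theta>) (b \<theta>) \<sigma> d\<^sub>x d\<^sub>y (W \<theta>) (V \<theta>) (X \<theta>) (Y \<theta>)"
    and "moment_estimator \<alpha> \<beta> (Psi f a b \<sigma>) est"
  shows "(\<forall>\<nu>>0. (\<lambda>T. SUP \<theta>\<in>{\<alpha><..<\<beta>}.
             measure (M \<theta>) {\<omega> \<in> space (M \<theta>). \<bar>est T (path_on {0..real T} (X \<theta>) \<omega>) - \<theta>\<bar> > \<nu>})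
           \<longlonglongrightarrow> 0) \<and>
         (\<forall>K. compact K \<longrightarrow> K \<subseteq> {\<alpha><..<\<beta>} \<longrightarrow>
           (\<forall>p::real. p \<ge> 2 \<longrightarrow>
             (\<exists>C>0. \<forall>T\<ge>1.
                (SUP \<theta>\<in>K. ennreal (real T powr (p / 2)) *
                   (\<integral>\<^sup>+ \<omega>. ennreal (\<bar>est T (path_on {0..real T} (X \<theta>) \<omega>) - \<theta>\<bar> powr p) \<partial>M \<theta>))
                \<le> ennreal C)))"
proof -
  let ?\<Theta> = "{\<alpha><..<\<beta>}"
  let ?\<Psi> = "Psi f a b \<sigma>"
  define \<epsilon> where "\<epsilon> T \<theta> \<omega> = \<bar>est T (path_on {0..real T} (X \<theta>) \<omega>) - \<theta>\<bar>" for T \<theta> \<omega>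
  define c where "c = (INF \<theta>\<in>?\<Theta>. \<bar>deriv ?\<Psi> \<theta>\<bar>)"
  have c: "0 < c" using assms(7) by (simp add: c_def)
  have c_le: "c \<le> \<bar>deriv ?\<Psi> \<theta>\<bar>" if "\<theta> \<in> ?\<Theta>" for \<theta>
    unfolding c_def by (rule cINF_lower[OF _ that]) (auto intro!: bdd_belowI[of _ 0])
  have sub: "\<theta> \<in> {\<alpha>..\<beta>}" if "\<theta> \<in> ?\<Theta>" for \<theta> using that by auto
  have expand: "c * \<bar>u - v\<bar> \<le> \<bar>?\<Psi> u - ?\<Psi> v\<bar>" if "u \<in> {\<alpha>..\<beta>}" "v \<in> {\<alpha>..\<beta>}" for u v
  proof (rule expanding_if_deriv_bounded_below[OF _ _ c_le that])
    have "a x \<noteq> 0" if "x \<in> {\<alpha>..\<beta>}" for x using assms(6)[OF that] by simp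
    then show "continuous_on {\<alpha>..\<beta>} ?\<Psi>"
      by (rule Psi_continuous[OF assms(3-5)])
    show "(?\<Psi> has_real_derivative deriv ?\<Psi> x) (at x)" if "x \<in> ?\<Theta>" for x
      using assms(6)[OF sub[OF that]] by (intro Psi_differentiable[OF assms(3-5) _ that]) simp
  qed
  have prob: "prob_space (M \<theta>)" and X_meas: "\<And>t. 0 \<le> t \<Longrightarrow> X \<theta> t \<in> borel_measurable (M \<theta>)"
    if "\<theta> \<in> ?\<Theta>" for \<theta>
    using assms(8)[OF that] unfolding partially_observed_system_def by auto
  have \<epsilon>_meas: "\<epsilon> T \<theta> \<in> borel_measurable (M \<theta>)" if "\<theta> \<in> ?\<Theta>" "1 \<le> T" for T \<theta>
    unfolding \<epsilon>_def[abs_def]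
    by (intro borel_measurable_abs borel_measurable_diff borel_measurable_const estimator_measurable[OF assms(9) that(2)] X_meas that(1))
  have \<epsilon>_le: "\<epsilon> T \<theta> \<omega> \<le> 2 / c * \<bar>R1 T (path_on {0..real T} (X \<theta>) \<omega>) - ?\<Psi> \<theta>\<bar>" if "\<theta> \<in> ?\<Theta>" "1 \<le> T" for T \<theta> \<omega>
    unfolding \<epsilon>_def by (rule moment_estimator_error[OF assms(9) that(2) _ expand c that(1)]) (auto simp: space_PiM)
  obtain F where F: "\<And>x. x \<in> {\<alpha>..\<beta>} \<Longrightarrow> \<bar>f x\<bar> \<le> F"
    by (rule continuous_bounded_Icc[OF twice_cont_diff_on_continuous[OF assms(3)]]) blast
  obtain B where B: "\<And>x. x \<in> {\<alpha>..\<beta>} \<Longrightarrow> \<bar>b x\<bar> \<le> B"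
    by (rule continuous_bounded_Icc[OF twice_cont_diff_on_continuous[OF assms(5)]]) blast
  obtain x\<^sub>0 where x0: "x\<^sub>0 \<in> {\<alpha>..\<beta>}" "\<And>x. x \<in> {\<alpha>..\<beta>} \<Longrightarrow> a x\<^sub>0 \<le> a x"
    using continuous_attains_inf[OF _ _ twice_cont_diff_on_continuous[OF assms(4)]] assms(1) by auto
  have even_bound: "\<exists>C\<ge>0. \<forall>\<theta>\<in>?\<Theta>. \<forall>T\<ge>1.
      (\<integral>\<^sup>+\<omega>. ennreal ((sqrt (real T) * \<epsilon> T \<theta> \<omega>) ^ (2*m)) \<partial>M \<theta>) \<le> ennreal C" if m: "1 \<le> m" for m
  proof -
    obtain C where C0: "0 \<le> C" and C: "\<And>\<theta> N T. \<theta> \<in> ?\<Theta> \<Longrightarrow> 0 < N \<Longrightarrow> 1 \<le> T \<Longrightarrow>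
     integrable (M \<theta>) (\<lambda>\<omega>. (\<Sum>k<T. (discrete_increment N (f \<theta>) (a \<theta>) (b \<theta>) \<sigma> (Y \<theta>) (V \<theta>) (W \<theta>) k \<omega>)\<^sup>2
         - discrete_Psi N (f \<theta>) (a \<theta>) (b \<theta>) \<sigma>) ^ (2*m)) \<and>
     (\<integral>\<omega>. (\<Sum>k<T. (discrete_increment N (f \<theta>) (a \<theta>) (b \<theta>) \<sigma> (Y \<theta>) (V \<theta>) (W \<theta>) k \<omega>)\<^sup>2
         - discrete_Psi N (f \<theta>) (a \<theta>) (b \<theta>) \<sigma>) ^ (2*m) \<partial>M \<theta>) \<le> C * real T ^ m"
      by (rule discrete_quadratic_moment_bound[of ?\<Theta> M f a b \<sigma> d\<^sub>x d\<^sub>y W V X Y F B "a x\<^sub>0" m])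
         (use assms(8) F B x0 assms(6) m sub in \<open>auto\<close>)
    show ?thesis
    proof (intro exI[of _ "(2 / c) ^ (2*m) * C"] conjI ballI allI impI)
      show "0 \<le> (2 / c) ^ (2*m) * C" using C0 c by simp
      fix \<theta> T assume \<theta>: "\<theta> \<in> ?\<Theta>" and T: "1 \<le> (T::nat)"
      define r where "r \<omega> = real T * (R1 T (path_on {0..real T} (X \<theta>) \<omega>) - ?\<Psi> \<theta>)" for \<omega>
      have r_meas: "r \<in> borel_measurable (M \<theta>)"
        unfolding r_def[abs_def] using X_meas[OF \<theta>]
        by (intro borel_measurable_times borel_measurable_diff borel_measurable_const R1_measurable)
      have pw: "(sqrt (real T) * \<epsilon> T \<theta> \<omega>) ^ (2*m) \<le> (2 / c) ^ (2*m) / real T ^ m * r \<omega> ^ (2*m)" for \<omega>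
      proof -
        have sq: "sqrt (real T) = real T / sqrt (real T)"
          using T by (simp add: real_div_sqrt)
        have "sqrt (real T) * \<epsilon> T \<theta> \<omega> \<le> sqrt (real T) * (2 / c * \<bar>R1 T (path_on {0..real T} (X \<theta>) \<omega>) - ?\<Psi> \<theta>\<bar>)"
          using \<epsilon>_le[OF \<theta> T] by (intro mult_left_mono) auto
        also have "\<dots> = 2 / c * \<bar>r \<omega>\<bar> / sqrt (real T)"
          by (subst sq) (simp add: r_def abs_mult)
        finally have "(sqrt (real T) * \<epsilon> T \<theta> \<omega>) ^ (2*m) \<le> (2 / c * \<bar>r \<omega>\<bar> / sqrt (real T)) ^ (2*m)"
          by (intro power_mono) (auto simp: \<epsilon>_def)
        also have "\<dots> = (2 / c) ^ (2*m) / real T ^ m * r \<omega> ^ (2*m)"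
          by (simp add: power_divide power_mult_distrib power_even_abs power_mult[of "sqrt (real T)"])
        finally show ?thesis .
      qed
      have k0: "0 \<le> (2 / c) ^ (2*m) / real T ^ m" using c by simp
      have "(\<integral>\<^sup>+\<omega>. ennreal ((sqrt (real T) * \<epsilon> T \<theta> \<omega>) ^ (2*m)) \<partial>M \<theta>)
          \<le> (\<integral>\<^sup>+\<omega>. ennreal ((2 / c) ^ (2*m) / real T ^ m) * ennreal (r \<omega> ^ (2*m)) \<partial>M \<theta>)"
        using pw k0 by (intro nn_integral_mono) (auto simp: zero_le_even_power simp flip: ennreal_mult intro!: ennreal_leI)
      also have "\<dots> = ennreal ((2 / c) ^ (2*m) / real T ^ m) * (\<integral>\<^sup>+\<omega>. ennreal (r \<omega> ^ (2*m)) \<partial>M \<theta>)"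
        using r_meas by (intro nn_integral_cmult) auto
      also have "(\<integral>\<^sup>+\<omega>. ennreal (r \<omega> ^ (2*m)) \<partial>M \<theta>) \<le> ennreal (C * real T ^ m)"
        using R1_moment_bound[OF assms(8)[OF \<theta>] _ T C[OF \<theta> _ T]] assms(6)[OF sub[OF \<theta>]]
        by (simp add: r_def Psi_def)
      also have "ennreal ((2 / c) ^ (2*m) / real T ^ m) * ennreal (C * real T ^ m) = ennreal ((2 / c) ^ (2*m) * C)"
        using k0 C0 T by (simp flip: ennreal_mult)
      finally show "(\<integral>\<^sup>+\<omega>. ennreal ((sqrt (real T) * \<epsilon> T \<theta> \<omega>) ^ (2*m)) \<partial>M \<theta>) \<le> ennreal ((2 / c) ^ (2*m) * C)"
        by (simp add: mult_left_mono)
    qed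
  qed
  have consistency: "(\<lambda>T. SUP \<theta>\<in>?\<Theta>. measure (M \<theta>) {\<omega> \<in> space (M \<theta>). \<epsilon> T \<theta> \<omega> > \<nu>}) \<longlonglongrightarrow> 0" if \<nu>: "0 < \<nu>" for \<nu>
  proof -
    obtain C where C0: "0 \<le> C" and C: "\<And>\<theta> T. \<theta> \<in> ?\<Theta> \<Longrightarrow> 1 \<le> T \<Longrightarrow>
        (\<integral>\<^sup>+\<omega>. ennreal ((sqrt (real T) * \<epsilon> T \<theta> \<omega>) ^ 2) \<partial>M \<theta>) \<le> ennreal C"
      using even_bound[of 1] by auto
    have ne: "?\<Theta> \<noteq> {}" using assms(1) by simp
    \<comment> \<open>Chebyshev's inequality\<close>
    have le: "measure (M \<theta>) {\<omega> \<in> space (M \<theta>). \<epsilon> T \<theta> \<omega> > \<nu>} \<le> C / (\<nu>\<^sup>2 * real T)" if \<theta>: "\<theta> \<in> ?\<Theta>" and T: "1 \<le> T" for T \<theta>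
    proof -
      interpret prob_space "M \<theta>" by (rule prob[OF \<theta>])
      note [measurable] = \<epsilon>_meas[OF \<theta> T]
      let ?A = "{\<omega> \<in> space (M \<theta>). \<epsilon> T \<theta> \<omega> > \<nu>}"
      have TN: "0 < \<nu>\<^sup>2 * real T" using \<nu> T by simp
      have "ennreal (\<nu>\<^sup>2 * real T) * emeasure (M \<theta>) ?A = (\<integral>\<^sup>+\<omega>. ennreal (\<nu>\<^sup>2 * real T) * indicator ?A \<omega> \<partial>M \<theta>)"
        by (subst nn_integral_cmult_indicator) auto
      also have "\<dots> \<le> (\<integral>\<^sup>+\<omega>. ennreal ((sqrt (real T) * \<epsilon> T \<theta> \<omega>) ^ 2) \<partial>M \<theta>)"
      proof (intro nn_integral_mono)
        fix \<omega>
        have "\<nu>\<^sup>2 * real T \<le> (sqrt (real T) * \<epsilon> T \<theta> \<omega>) ^ 2" if "\<nu> < \<epsilon> T \<theta> \<omega>"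
        proof -
          have "\<nu>\<^sup>2 \<le> (\<epsilon> T \<theta> \<omega>)\<^sup>2" using that \<nu> by (intro power_mono) auto
          then show ?thesis by (simp add: power_mult_distrib mult.commute mult_left_mono)
        qed
        then show "ennreal (\<nu>\<^sup>2 * real T) * indicator ?A \<omega> \<le> ennreal ((sqrt (real T) * \<epsilon> T \<theta> \<omega>) ^ 2)"
          by (auto simp: indicator_def intro: ennreal_leI)
      qed
      also have "\<dots> \<le> ennreal C" by (rule C[OF \<theta> T])
      finally have "ennreal (\<nu>\<^sup>2 * real T * measure (M \<theta>) ?A) \<le> ennreal C"
        using TN by (simp add: emeasure_eq_measure ennreal_mult)
      then have "\<nu>\<^sup>2 * real T * measure (M \<theta>) ?A \<le> C"
        using C0 by (simp add: ennreal_le_iff)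
      then show ?thesis using TN by (simp add: pos_le_divide_eq mult.commute)
    qed
    have bdd: "bdd_above ((\<lambda>\<theta>. measure (M \<theta>) {\<omega> \<in> space (M \<theta>). \<epsilon> T \<theta> \<omega> > \<nu>}) ` ?\<Theta>)" for T
      using prob by (intro bdd_aboveI[of _ 1]) (auto intro: prob_space.prob_le_1)
    have lower: "0 \<le> (SUP \<theta>\<in>?\<Theta>. measure (M \<theta>) {\<omega> \<in> space (M \<theta>). \<epsilon> T \<theta> \<omega> > \<nu>})" for T
    proof -
      obtain \<theta> where \<theta>: "\<theta> \<in> ?\<Theta>" using ne by blast
      show ?thesis by (rule cSUP_upper2[OF bdd \<theta>]) simp
    qed
    show ?thesis
    proof (rule tendsto_sandwich[OF _ _ tendsto_const])
      show "\<forall>\<^sub>F T in sequentially. 0 \<le> (SUP \<theta>\<in>?\<Theta>. measure (M \<theta>) {\<omega> \<in> space (M \<theta>). \<epsilon> T \<theta> \<omega> > \<nu>})"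
        using lower by simp
      show "\<forall>\<^sub>F T in sequentially. (SUP \<theta>\<in>?\<Theta>. measure (M \<theta>) {\<omega> \<in> space (M \<theta>). \<epsilon> T \<theta> \<omega> > \<nu>}) \<le> C / (\<nu>\<^sup>2 * real T)"
        using eventually_ge_at_top[of 1] by eventually_elim (intro cSUP_least ne le)
      show "(\<lambda>T. C / (\<nu>\<^sup>2 * real T)) \<longlonglongrightarrow> 0"
        using \<nu> by real_asymp
    qed
  qed
  have moments: "\<exists>C>0. \<forall>T\<ge>1. (SUP \<theta>\<in>K. ennreal (real T powr (p / 2)) * (\<integral>\<^sup>+ \<omega>. ennreal (\<epsilon> T \<theta> \<omega> powr p) \<partial>M \<theta>)) \<le> ennreal C"
    if K: "K \<subseteq> ?\<Theta>" and p: "2 \<le> p" for K and p :: real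
  proof -
    obtain m :: nat where m: "p \<le> real m" using real_arch_simple by blast
    then have m1: "1 \<le> m" "p \<le> 2 * real m" using p by (auto intro: order_trans)
    obtain C where C0: "0 \<le> C" and C: "\<And>\<theta> T. \<theta> \<in> ?\<Theta> \<Longrightarrow> 1 \<le> T \<Longrightarrow>
        (\<integral>\<^sup>+\<omega>. ennreal ((sqrt (real T) * \<epsilon> T \<theta> \<omega>) ^ (2*m)) \<partial>M \<theta>) \<le> ennreal C"
      using even_bound[OF m1(1)] by auto
    have "ennreal (real T powr (p / 2)) * (\<integral>\<^sup>+ \<omega>. ennreal (\<epsilon> T \<theta> \<omega> powr p) \<partial>M \<theta>) \<le> ennreal (1 + C)"
      if "\<theta> \<in> K" and T: "1 \<le> T" for \<theta> T
    proof -
      have \<theta>: "\<theta> \<in> ?\<Theta>" using that K by auto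
      interpret prob_space "M \<theta>" by (rule prob[OF \<theta>])
      note [measurable] = \<epsilon>_meas[OF \<theta> T]
      have \<epsilon>0: "0 \<le> \<epsilon> T \<theta> \<omega>" for \<omega> by (simp add: \<epsilon>_def)
      have "ennreal (real T powr (p / 2)) * (\<integral>\<^sup>+ \<omega>. ennreal (\<epsilon> T \<theta> \<omega> powr p) \<partial>M \<theta>)
          = (\<integral>\<^sup>+ \<omega>. ennreal (real T powr (p / 2)) * ennreal (\<epsilon> T \<theta> \<omega> powr p) \<partial>M \<theta>)"
        by (rule nn_integral_cmult[symmetric]) measurable
      also have "\<dots> = (\<integral>\<^sup>+ \<omega>. ennreal ((sqrt (real T) * \<epsilon> T \<theta> \<omega>) powr p) \<partial>M \<theta>)"
      proof (intro nn_integral_cong)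
        fix \<omega>
        have "real T powr (p / 2) = sqrt (real T) powr p"
          by (simp add: powr_half_sqrt[symmetric] powr_powr)
        then show "ennreal (real T powr (p / 2)) * ennreal (\<epsilon> T \<theta> \<omega> powr p) = ennreal ((sqrt (real T) * \<epsilon> T \<theta> \<omega>) powr p)"
          using \<epsilon>0 by (simp add: powr_mult flip: ennreal_mult)
      qed
      also have "\<dots> \<le> (\<integral>\<^sup>+ \<omega>. 1 + ennreal ((sqrt (real T) * \<epsilon> T \<theta> \<omega>) ^ (2*m)) \<partial>M \<theta>)"
      proof (intro nn_integral_mono)
        fix \<omega>
        have "ennreal ((sqrt (real T) * \<epsilon> T \<theta> \<omega>) powr p) \<le> ennreal (1 + (sqrt (real T) * \<epsilon> T \<theta> \<omega>) ^ (2*m))"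
          using \<epsilon>0 p m1(2) by (intro ennreal_leI powr_le_one_plus_even_power) auto
        then show "ennreal ((sqrt (real T) * \<epsilon> T \<theta> \<omega>) powr p) \<le> 1 + ennreal ((sqrt (real T) * \<epsilon> T \<theta> \<omega>) ^ (2*m))"
          using \<epsilon>0 by (simp add: ennreal_plus)
      qed
      also have "\<dots> = 1 + (\<integral>\<^sup>+ \<omega>. ennreal ((sqrt (real T) * \<epsilon> T \<theta> \<omega>) ^ (2*m)) \<partial>M \<theta>)"
        by (subst nn_integral_add) (auto simp: emeasure_space_1)
      also have "\<dots> \<le> 1 + ennreal C"
        by (intro add_left_mono C[OF \<theta> T])
      also have "\<dots> = ennreal (1 + C)" using C0 by (simp add: ennreal_plus)
      finally show ?thesis .
    qed
    then show ?thesis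
      using C0 by (intro exI[of _ "1 + C"] conjI allI impI SUP_least) auto
  qed
  show ?thesis
    using consistency moments unfolding \<epsilon>_def by blast
qed

end
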